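(* Let $k\ge 0$ and let $b$ be Lipschitz continuous and $1$-periodic. Then: (i) For any $u\in L^2$ (extended $1$-periodically) and any $t\in\mathbb R$, the function $\tilde u(x):=u(y_x(-t))$ satisfies $$\|\tilde u\|_{L^2}\le e^{\frac12L|t|}\,\|u\|_{L^2},\qquad\text{where } L:=\|b'\|_{L^\infty}.$$ (ii) If furthermore $b$ is of class $C^{2k+2}$, there exists a constant $C_1\ge 0$ (independent of $\Delta t$, $\Delta x$ and $u$) such that $$\|\widetilde{\mathcal T}_{b,\Delta t}u\|_{L^2}\le e^{C_1\Delta t}\|u\|_{L^2}\qquad\forall u\in V_k.$$ (iii) In particular (under the assumption of (ii)), for the scheme $u^{n+1}=\widetilde{\mathcal T}_{b,\Delta t}u^n$ with $u^0\in V_k$, $$\|u^n\|_{L^2}\le e^{C_1t_n}\|u^0\|_{L^2},\qquad\forall n\ge 0,\quad t_n=n\Delta t.$$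
   Context: Setting. $\Omega=(0,1)$; functions on $\Omega$ are identified with their $1$-periodic extensions to $\mathbb R$. $L^2=L^2(\Omega)$ with inner product $(\cdot,\cdot)$ and norm $\|\cdot\|_{L^2}$. $T>0$ is fixed, $N\ge1$ integer, $\Delta t=T/N$. $M\ge 1$ integer, $\Delta x=1/M$, cells $I_i=(i\Delta x,(i+1)\Delta x)$, $i=0,\dots,M-1$. $V_k=\{v\in L^2(\Omega): v|_{I_i}\text{ is a polynomial of degree}\le k,\ \forall i\}$. Characteristics. For $x\in\mathbb R$, $t\mapsto y_x(t)$ is the solution of $\dot y(t)=b(y(t))$, $t\in\mathbb R$, $y(0)=x$. Quadrature. $\{x_\alpha\}_{\alpha=0}^k\subset(-1,1)$ and weights $w_\alpha>0$ are the $(k+1)$-point Gauss–Legendre rule on $(-1,1)$ (exact for polynomials of degree $\le 2k+1$). For each $i$, let $x_{i,1}<\dots<x_{i,p_i}$ be the (finitely many) points $x\in I_i$ such that $y_x(-\Delta t)\in\Delta x\,\mathbb Z$ (i.e. is a mesh node), and $x_{i,0}=i\Delta x$, $x_{i,p_i+1}=(i+1)\Delta x$. Set $\tilde w^i_{q,\alpha}=\frac{w_\alpha}{2}(x_{i,q+1}-x_{i,q})$ and $\tilde x^i_{q,\alpha}=\frac{x_{i,q}+x_{i,q+1}}2+x_\alpha\frac{x_{i,q+1}-x_{i,q}}2$, and $$(f,g)_G:=\sum_{i=0}^{M-1}\sum_{q=0}^{p_i}\sum_{\alpha=0}^k\tilde w^i_{q,\alpha}\,f(\tilde x^i_{q,\alpha})\,g(\tilde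 x^i_{q,\alpha}).$$ Scheme. $\widetilde{\mathcal T}_{b,\Delta t}u$ is the unique element of $V_k$ with $(\widetilde{\mathcal T}_{b,\Delta t}u,\varphi)=(u(y_\cdot(-\Delta t)),\varphi)_G$ for all $\varphi\in V_k$. *)

theory Defs
  imports
    "HOL-Probability.Essential_Supremum"
    "HOL-Library.Periodic_Fun"
    "HOL-Computational_Algebra.Polynomial"
begin

definition Omega :: "real set" where
  "Omega = {0<..<1}"

text \<open>Elements of \<open>L\<^sup>2(\<Omega>)\<close> are handled through representatives, extended 1-periodically to the
  real line. The locale predicate \<open>periodic_fun_simple' u\<close> says \<open>u (x + 1) = u x\<close> for all \<open>x\<close>.\<close>

definition L2per :: "(real \<Rightarrow> real) set" where
  "L2per = {u. periodic_fun_simple' u \<and> u \<in> borel_measurable (lebesgue_on Omega) \<and>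
               integrable (lebesgue_on Omega) (\<lambda>x. (u x)\<^sup>2)}"

definition L2inner :: "(real \<Rightarrow> real) \<Rightarrow> (real \<Rightarrow> real) \<Rightarrow> real" where
  "L2inner f g = (LINT x|lebesgue_on Omega. f x * g x)"

definition L2norm :: "(real \<Rightarrow> real) \<Rightarrow> real" where
  "L2norm f = sqrt (LINT x|lebesgue_on Omega. (f x)\<^sup>2)"

text \<open>\<open>\<parallel>b'\<parallel>\<close> in \<open>L\<^sup>\<infinity>(\<Omega>)\<close>. A Lipschitz \<open>b\<close> is differentiable almost everywhere, so the unspecified
  value of \<open>deriv b\<close> at the other points does not matter, and the essential supremum is finite.\<close>

definition Linf_deriv :: "(real \<Rightarrow> real) \<Rightarrow> real" where
  "Linf_deriv b = real_of_ereal (esssup (lebesgue_on Omega) (\<lambda>x. ereal \<bar>deriv b x\<bar>))"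

definition class_C :: "nat \<Rightarrow> (real \<Rightarrow> real) \<Rightarrow> bool" where
  "class_C m f \<longleftrightarrow> (\<forall>j<m. (deriv ^^ j) f differentiable_on UNIV) \<and>
                   continuous_on UNIV ((deriv ^^ m) f)"

text \<open>\<open>y x t\<close> is \<open>y\<^sub>x(t)\<close>; for Lipschitz \<open>b\<close> there is exactly one such \<open>y\<close>.\<close>

definition characteristics :: "(real \<Rightarrow> real) \<Rightarrow> (real \<Rightarrow> real \<Rightarrow> real) \<Rightarrow> bool" where
  "characteristics b y \<longleftrightarrow>
     (\<forall>x. y x 0 = x \<and> (\<forall>t. (y x has_real_derivative b (y x t)) (at t)))"

text \<open>Nodes \<open>\<xi> 0, \<dots>, \<xi> k\<close> and weights \<open>w 0, \<dots>, w k\<close>. Exactness up to degree \<open>2k + 1\<close>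
  determines the rule up to the numbering of its nodes.\<close>

definition gauss_legendre :: "nat \<Rightarrow> (nat \<Rightarrow> real) \<Rightarrow> (nat \<Rightarrow> real) \<Rightarrow> bool" where
  "gauss_legendre k \<xi> w \<longleftrightarrow>
     inj_on \<xi> {..k} \<and> (\<forall>\<alpha>\<le>k. -1 < \<xi> \<alpha> \<and> \<xi> \<alpha> < 1 \<and> 0 < w \<alpha>) \<and>
     (\<forall>p :: real poly. degree p \<le> 2 * k + 1 \<longrightarrow>
        (\<Sum>\<alpha>\<le>k. w \<alpha> * poly p (\<xi> \<alpha>)) = integral {-1..1} (poly p))"

text \<open>From here on \<open>M\<close> is the number of cells, so that \<open>\<Delta>x = 1 / M\<close>.\<close>

definition cell :: "nat \<Rightarrow> nat \<Rightarrow> real set" where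
  "cell M i = {real i / real M <..< (real i + 1) / real M}"

text \<open>Values at the mesh nodes are left free, in accordance with equality in \<open>L\<^sup>2\<close>.\<close>

definition V :: "nat \<Rightarrow> nat \<Rightarrow> (real \<Rightarrow> real) set" where
  "V k M = {v \<in> L2per. \<forall>i<M. \<exists>p :: real poly. degree p \<le> k \<and> (\<forall>x\<in>cell M i. v x = poly p x)}"

text \<open>The points of cell \<open>i\<close> whose characteristic meets a mesh node at time \<open>-\<Delta>t\<close>. This set is
  finite when \<open>y\<close> are the characteristics of a Lipschitz 1-periodic \<open>b\<close>.\<close>

definition breaks :: "(real \<Rightarrow> real \<Rightarrow> real) \<Rightarrow> real \<Rightarrow> nat \<Rightarrow> nat \<Rightarrow> real set" where
  "breaks y dt M i = {x \<in> cell M i. \<exists>j :: int. y x (- dt) = real_of_int j / real M}"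

text \<open>\<open>sub_pt y dt M i q\<close> is \<open>x\<^sub>i\<^sub>,\<^sub>q\<close> for \<open>0 \<le> q \<le> p\<^sub>i + 1\<close>, where \<open>p\<^sub>i = card (breaks y dt M i)\<close>.\<close>

definition sub_pt :: "(real \<Rightarrow> real \<Rightarrow> real) \<Rightarrow> real \<Rightarrow> nat \<Rightarrow> nat \<Rightarrow> nat \<Rightarrow> real" where
  "sub_pt y dt M i q =
     ([real i / real M] @ sorted_list_of_set (breaks y dt M i) @ [(real i + 1) / real M]) ! q"

definition quad_weight ::
  "(nat \<Rightarrow> real) \<Rightarrow> (real \<Rightarrow> real \<Rightarrow> real) \<Rightarrow> real \<Rightarrow> nat \<Rightarrow> nat \<Rightarrow> nat \<Rightarrow> nat \<Rightarrow> real" where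
  "quad_weight w y dt M i q \<alpha> = w \<alpha> / 2 * (sub_pt y dt M i (q + 1) - sub_pt y dt M i q)"

definition quad_node ::
  "(nat \<Rightarrow> real) \<Rightarrow> (real \<Rightarrow> real \<Rightarrow> real) \<Rightarrow> real \<Rightarrow> nat \<Rightarrow> nat \<Rightarrow> nat \<Rightarrow> nat \<Rightarrow> real" where
  "quad_node \<xi> y dt M i q \<alpha> =
     (sub_pt y dt M i q + sub_pt y dt M i (q + 1)) / 2
       + \<xi> \<alpha> * ((sub_pt y dt M i (q + 1) - sub_pt y dt M i q) / 2)"

definition innerG ::
  "nat \<Rightarrow> (nat \<Rightarrow> real) \<Rightarrow> (nat \<Rightarrow> real) \<Rightarrow> (real \<Rightarrow> real \<Rightarrow> real) \<Rightarrow> real \<Rightarrow> nat \<Rightarrow>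
     (real \<Rightarrow> real) \<Rightarrow> (real \<Rightarrow> real) \<Rightarrow> real" where
  "innerG k \<xi> w y dt M f g =
     (\<Sum>i<M. \<Sum>q\<le>card (breaks y dt M i). \<Sum>\<alpha>\<le>k.
        quad_weight w y dt M i q \<alpha> * f (quad_node \<xi> y dt M i q \<alpha>) * g (quad_node \<xi> y dt M i q \<alpha>))"

text \<open>The unique element of \<open>V k M\<close> defining the scheme is unique as an element of \<open>L\<^sup>2\<close>, that is,
  up to its values at the mesh nodes; the representative vanishing there is chosen. The choice is
  immaterial: neither \<open>L2norm\<close> nor a further application of the scheme depends on these values,
  since no quadrature point is a mesh node or is transported to one.\<close>

definition Tscheme ::
  "nat \<Rightarrow> (nat \<Rightarrow> real) \<Rightarrow> (nat \<Rightarrow> real) \<Rightarrow> (real \<Rightarrow> real \<Rightarrow> real) \<Rightarrow> real \<Rightarrow> nat \<Rightarrow>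
     (real \<Rightarrow> real) \<Rightarrow> (real \<Rightarrow> real)" where
  "Tscheme k \<xi> w y dt M u =
     (THE v. v \<in> V k M \<and> (\<forall>j :: int. v (real_of_int j / real M) = 0) \<and>
        (\<forall>\<phi>\<in>V k M. L2inner v \<phi> = innerG k \<xi> w y dt M (\<lambda>x. u (y x (- dt))) \<phi>))"

end

theory Submission
  imports Defs
begin

text \<open>Part (i). A Lipschitz function on the line is differentiable almost everywhere and its
  derivative bound is a Lipschitz constant, so \<open>b\<close> is Lipschitz with constant \<open>Linf_deriv b\<close>. By
  Gronwall the flow and its inverse are Lipschitz with constant \<open>exp (L * \<bar>t\<bar>)\<close>, and Lebesgue measure
  transported by the flow is at most \<open>exp (L * \<bar>t\<bar>)\<close> times Lebesgue measure.

  Part (ii). Let \<open>v\<close> be the image of \<open>u\<close> under the scheme. Testing with \<open>v\<close>, on which the quadrature is exact,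
  and using \<open>2 f v \<le> f\<^sup>2 + v\<^sup>2\<close> at the nodes bounds \<open>\<parallel>v\<parallel>\<^sup>2\<close> by the quadrature sum of \<open>f\<^sup>2\<close>, where \<open>f\<close> is
  \<open>u\<close> transported. On a subinterval \<open>J\<close> this sum samples a polynomial on the image of \<open>J\<close> at the
  transported Gauss nodes. Relative to the Gauss nodes of the image they are displaced only by
  \<open>O(dt)\<close> times its length, since the flow is bi-Lipschitz with constants \<open>1 + O(dt)\<close>. On polynomials of
  degree at most \<open>k\<close> the Gauss quadrature of the square is the square of a norm, so the displacement costs a
  factor \<open>1 + O(dt)\<close>, uniformly in \<open>J\<close>.\<close>

section \<open>Lipschitz functions on the line\<close>

text \<open>The constant in (i) is the essential supremum of the derivative, whereas the Lipschitz
  hypothesis only provides some K that may be larger. Passing from one to the other takes almost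
  everywhere differentiability and a mean value inequality that tolerates a null set. Both are
  obtained for the monotone function f x + K x, whose Stieltjes measure is compared with Lebesgue
  measure through Vitali coverings. Comparison of measures also replaces the change of variables
  formula, because the flow of a Lipschitz field need not be differentiable in its starting point.

  In (ii) the difficulty is uniformity: the loss per step must be 1 + C dt with C independent of the
  mesh and of the subintervals, since a fixed factor per step would be fatal after N steps. Each
  image interval is therefore rescaled to [-1, 1], where only the rule and k enter and where
  displacements of nodes are measured relative to the interval. Monotonicity of the flow keeps the
  displaced nodes inside [-1, 1].\<close>

lemma emeasure_le_lborel_of_lipschitz:
  fixes M :: "real measure" and g :: "real \<Rightarrow> real"
  assumes sets: "sets M = sets borel"
    and inc: "\<And>a b. a \<le> b \<Longrightarrow> emeasure M {a<..b} = ennreal (g b - g a)"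
    and mono: "mono g" and lip: "C-lipschitz_on UNIV g"
    and A: "A \<in> sets borel"
  shows "emeasure M A \<le> ennreal C * emeasure lborel A"
proof -
  \<comment> \<open>The deficit \<open>h\<close> is nondecreasing, and its Stieltjes measure
    \<open>N\<close> complements \<open>M\<close>: on half-open intervals the sum of the two is C
    times Lebesgue measure. Extending this identity to Borel sets and dropping \<open>N\<close>
    gives the inequality.\<close>
  define h where "h = (\<lambda>x. C * x - g x)"
  define N where "N = interval_measure h"
  have C0: "0 \<le> C"
    using lip lipschitz_on_nonneg by blast
  have g_inc: "0 \<le> g b - g a" "g b - g a \<le> C * (b - a)" if "a \<le> b" for a b
    using monoD[OF mono that] lipschitz_onD[OF lip, of b a] that by (auto simp: dist_real_def)
  have h_mono: "h a \<le> h b" if "a \<le> b" for a b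
    using g_inc(2)[OF that] by (simp add: h_def algebra_simps)
  have "continuous_on UNIV h"
    unfolding h_def by (intro continuous_intros lipschitz_on_continuous_on[OF lip])
  then have N_inc: "emeasure N {a<..b} = ennreal (h b - h a)" if "a \<le> b" for a b
    unfolding N_def using that h_mono
    by (intro emeasure_interval_measure_Ioc) (auto simp: continuous_on_eq_continuous_at continuous_at_imp_continuous_at_within)
  have [measurable_cong]: "sets N = sets borel"
    by (simp add: N_def)
  note sets[measurable_cong]
  \<comment> \<open>All the measures are finite on the windows \<open>B n\<close>. The complement
    step of the induction cancels a finite term there, and the increasing union of the windows
    restores the whole line.\<close>
  define B where "B = (\<lambda>n::nat. {- real n <.. real n})"
  have [measurable]: "B n \<in> sets borel" for n
    by (simp add: B_def)
  have fin: "emeasure M (B n) < \<infinity>" "emeasure N (B n) < \<infinity>" "emeasure lborel (B n) < \<infinity>" for n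
    by (simp_all add: B_def inc N_inc)
  have fin': "emeasure M (X \<inter> B n) < \<infinity>" "emeasure N (X \<inter> B n) < \<infinity>" "emeasure lborel (X \<inter> B n) < \<infinity>"
    for X n
    using fin[of n] emeasure_mono[of "X \<inter> B n" "B n" M] emeasure_mono[of "X \<inter> B n" "B n" N]
      emeasure_mono[of "X \<inter> B n" "B n" lborel] sets
    by (auto intro: le_less_trans)
  have Ioc: "{a<..b} \<inter> B n = {max a (- real n)<..min b (real n)}" for a b n
    by (auto simp: B_def)
  have sum_Ioc: "emeasure M {a<..b} + emeasure N {a<..b} = ennreal C * emeasure lborel {a<..b}" for a b
  proof (cases "a \<le> b")
    case True
    then show ?thesis
      using g_inc[OF True] h_mono[OF True] C0
      by (simp add: inc N_inc ennreal_plus[symmetric] ennreal_mult[symmetric] h_def algebra_simps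
          del: ennreal_plus)
  qed simp
  have "emeasure M (A \<inter> B n) + emeasure N (A \<inter> B n) = ennreal C * emeasure lborel (A \<inter> B n)" for n
  proof -
    have "Int_stable (range (\<lambda>(a, b). {a<..b::real}))"
      by (auto simp: Int_stable_def image_iff)
    moreover have "range (\<lambda>(a, b). {a<..b::real}) \<subseteq> Pow UNIV"
      by simp
    moreover have borel_eq: "sets borel = sigma_sets UNIV (range (\<lambda>(a, b). {a<..b::real}))"
      by (simp add: borel_sigma_sets_Ioc)
    then have "A \<in> sigma_sets UNIV (range (\<lambda>(a, b). {a<..b::real}))"
      using A by simp
    ultimately show ?thesis
    proof (induction rule: sigma_sets_induct_disjoint)
      case (basic A)
      then show ?case by (auto simp: Ioc sum_Ioc)
    next
      case empty
      then show ?case by simp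
    next
      case (compl A)
      then have [measurable]: "A \<in> sets borel"
        using borel_eq by simp
      have eq: "(UNIV - A) \<inter> B n = B n - A \<inter> B n"
        by auto
      have D: "emeasure \<mu> (B n) = emeasure \<mu> (A \<inter> B n) + emeasure \<mu> ((UNIV - A) \<inter> B n)"
        if "sets \<mu> = sets borel" for \<mu> :: "real measure"
        using that by (subst plus_emeasure) (auto intro!: arg_cong[where f = "emeasure \<mu>"])
      have "emeasure M (B n) + emeasure N (B n) = ennreal C * emeasure lborel (B n)"
        by (simp add: B_def sum_Ioc)
      then have "(emeasure M (A \<inter> B n) + emeasure N (A \<inter> B n)) +
          (emeasure M ((UNIV - A) \<inter> B n) + emeasure N ((UNIV - A) \<inter> B n)) =
          ennreal C * emeasure lborel (A \<inter> B n) + ennreal C * emeasure lborel ((UNIV - A) \<inter> B n)"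
        using D[of M] D[of N] D[of lborel] sets
        by (simp add: N_def ac_simps distrib_left)
      moreover have "ennreal C * emeasure lborel (A \<inter> B n) \<noteq> top"
        using fin'(3)[of A n] by (simp add: ennreal_mult_eq_top_iff)
      ultimately show ?case
        unfolding compl(2) by (simp only: ennreal_add_left_cancel) simp
    next
      case (union A)
      then have [measurable]: "A i \<in> sets borel" for i
        using borel_eq by auto
      have dis: "disjoint_family (\<lambda>i. A i \<inter> B n)"
        using union(1) by (auto simp: disjoint_family_on_def)
      have S: "emeasure \<mu> ((\<Union>i. A i) \<inter> B n) = (\<Sum>i. emeasure \<mu> (A i \<inter> B n))"
        if "sets \<mu> = sets borel" for \<mu> :: "real measure"
      proof -
        have "A i \<inter> B n \<in> sets borel" for i
          by measurable
        then have "range (\<lambda>i. A i \<inter> B n) \<subseteq> sets \<mu>"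
          unfolding that by blast
        from suminf_emeasure[OF this dis] show ?thesis
          by simp
      qed
      have "emeasure M ((\<Union>i. A i) \<inter> B n) + emeasure N ((\<Union>i. A i) \<inter> B n)
        = (\<Sum>i. emeasure M (A i \<inter> B n) + emeasure N (A i \<inter> B n))"
        using S[of M] S[of N] sets by (simp add: N_def suminf_add)
      also have "\<dots> = ennreal C * emeasure lborel ((\<Union>i. A i) \<inter> B n)"
        using S[of lborel] union(3) by simp
      finally show ?case .
    qed
  qed
  then have "emeasure M (A \<inter> B n) \<le> ennreal C * emeasure lborel (A \<inter> B n)" for n
    by (metis le_iff_add)
  moreover have "ennreal C * emeasure lborel (A \<inter> B n) \<le> ennreal C * emeasure lborel A" for n
    using A by (intro mult_left_mono emeasure_mono) auto
  ultimately have le: "emeasure M (A \<inter> B n) \<le> ennreal C * emeasure lborel A" for n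
    by (meson order_trans)
  have "incseq (\<lambda>n. A \<inter> B n)"
    by (auto simp: incseq_def B_def)
  moreover have "(\<Union>n. A \<inter> B n) = A"
  proof -
    have "\<exists>n::nat. - real n < x \<and> x \<le> real n" for x
    proof -
      obtain n :: nat where "\<bar>x\<bar> < real n" using reals_Archimedean2 by blast
      then show ?thesis by (intro exI[of _ n]) auto
    qed
    then show ?thesis by (auto simp: B_def)
  qed
  ultimately have "(\<lambda>n. emeasure M (A \<inter> B n)) \<longlonglongrightarrow> emeasure M A"
    using Lim_emeasure_incseq[of "\<lambda>n. A \<inter> B n" M] A sets by (auto simp: image_subset_iff)
  then show ?thesis
    using le by (intro LIMSEQ_le_const2) auto
qed

text \<open>The balls on which \<open>M1\<close> is dominated by \<open>M2\<close> form a Vitali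
  cover of \<open>S\<close>. A countable disjoint subfamily exhausts \<open>S\<close> up to a null
  set, and countable additivity sums the inequalities. The balls only have to contain the point, not
  to be centred at it, which suits difference quotients taken from one side.\<close>

lemma Vitali_emeasure_le:
  fixes M1 M2 :: "'a::euclidean_space measure"
  assumes sets: "sets M1 = sets borel" "sets M2 = sets borel"
    and W: "open W" "S \<subseteq> W"
    and cov: "\<And>x d. x \<in> S \<Longrightarrow> 0 < d \<Longrightarrow>
      \<exists>c r. x \<in> ball c r \<and> r < d \<and> emeasure M1 (ball c r) \<le> emeasure M2 (ball c r)"
  obtains U where "open U" "U \<subseteq> W" "negligible (S - U)" "emeasure M1 U \<le> emeasure M2 U"
proof -
  define K where "K = {(c, r). ball c r \<subseteq> W \<and> emeasure M1 (ball c r) \<le> emeasure M2 (ball c r)}"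
  obtain C where C: "countable C" "C \<subseteq> K"
    "pairwise (\<lambda>i j. disjnt (ball (fst i) (snd i)) (ball (fst j) (snd j))) C"
    "negligible (S - (\<Union>i \<in> C. ball (fst i) (snd i)))"
  proof (rule Vitali_covering_theorem_balls [of S K fst snd])
    fix x :: 'a and d :: real
    assume x: "x \<in> S" and d: "0 < d"
    then obtain e where e: "0 < e" "ball x e \<subseteq> W"
      using W by (metis openE subsetD)
    \<comment> \<open>Since x is not the centre, the points of the ball are only known to be within
      2 r of x. Hence the bound e / 2.\<close>
    then obtain c r where cr: "x \<in> ball c r" "r < min d (e / 2)"
      "emeasure M1 (ball c r) \<le> emeasure M2 (ball c r)"
      using cov[OF x, of "min d (e / 2)"] d by auto
    have "ball c r \<subseteq> ball x e"
    proof
      fix z assume "z \<in> ball c r"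
      then have "dist x z < 2 * r"
        using cr(1) dist_triangle[of x z c] by (simp add: dist_commute)
      then show "z \<in> ball x e"
        using cr(2) by simp
    qed
    then show "\<exists>i. i \<in> K \<and> x \<in> ball (fst i) (snd i) \<and> snd i < d"
      using cr e by (intro exI[of _ "(c, r)"]) (auto simp: K_def)
  qed
  let ?U = "\<Union>i \<in> C. ball (fst i) (snd i)"
  have "disjoint_family_on (\<lambda>i. ball (fst i) (snd i)) C"
    using C(3) by (auto simp: disjoint_family_on_def pairwise_def disjnt_def)
  then have U: "emeasure M ?U = (\<integral>\<^sup>+i. emeasure M (ball (fst i) (snd i)) \<partial>count_space C)"
    if "sets M = sets borel" for M :: "'a measure"
    using that C(1) by (subst emeasure_UN_countable) auto
  show thesis
  proof
    show "emeasure M1 ?U \<le> emeasure M2 ?U"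
      using C(2) unfolding U[OF sets(1)] U[OF sets(2)]
      by (intro nn_integral_mono) (auto simp: K_def)
    show "?U \<subseteq> W"
      using C(2) by (fastforce simp: K_def)
  qed (use C in auto)
qed

section \<open>Stieltjes increments over balls and difference quotients\<close>

lemma emeasure_interval_measure_ball:
  fixes g :: "real \<Rightarrow> real"
  assumes g: "mono g" "continuous_on UNIV g" and r: "0 < r"
  shows "emeasure (interval_measure g) (ball c r) = ennreal (g (c + r) - g (c - r))"
proof -
  have Ioc: "emeasure (interval_measure g) {a<..b} = ennreal (g b - g a)" if "a \<le> b" for a b
    using that g by (intro emeasure_interval_measure_Ioc)
      (auto simp: mono_def continuous_on_eq_continuous_at continuous_at_imp_continuous_at_within)
  have "emeasure (interval_measure g) {c + r..c + r} = ennreal (g (c + r) - g (c + r))"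
    using g by (intro emeasure_interval_measure_Icc) (auto simp: mono_def)
  then have "{c + r} \<in> null_sets (interval_measure g)"
    by auto
  then have "emeasure (interval_measure g) ({c - r<..c + r} - {c + r}) = emeasure (interval_measure g) {c - r<..c + r}"
    by (intro emeasure_Diff_null_set) auto
  moreover have "{c - r<..c + r} - {c + r} = ball c r"
    by (auto simp: ball_eq_greaterThanLessThan)
  ultimately show ?thesis
    using r by (simp add: Ioc)
qed

text \<open>The interval between x and y is a ball with x on its boundary. The strict slope
  inequality is stable under a small increase of the radius about the midpoint, and this increase
  brings x inside.\<close>

lemma small_ball_increment_less:
  fixes g :: "real \<Rightarrow> real"
  assumes g: "continuous_on UNIV g"
    and y: "y \<noteq> x" "\<bar>y - x\<bar> < d" "(g y - g x) / (y - x) < a"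
  obtains c r where "x \<in> ball c r" "r < d" "g (c + r) - g (c - r) < a * (2 * r)"
proof -
  define c where "c = (x + y) / 2"
  define r0 where "r0 = \<bar>y - x\<bar> / 2"
  define h where "h = (\<lambda>r. a * (2 * r) - (g (c + r) - g (c - r)))"
  have "g (c + r0) - g (c - r0) < a * (2 * r0)"
  proof (cases "x < y")
    case True
    then have "c + r0 = y" "c - r0 = x" "2 * r0 = y - x"
      by (auto simp: c_def r0_def field_simps)
    then show ?thesis
      using y(3) True by (simp only: divide_less_eq)
  next
    case False
    then have "c + r0 = x" "c - r0 = y" "2 * r0 = x - y" "y < x"
      using y by (auto simp: c_def r0_def field_simps)
    moreover from this have "a * (y - x) < g y - g x"
      using y(3) by (simp add: divide_less_eq)
    then have "g x - g y < a * (x - y)"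
      by (simp add: algebra_simps)
    ultimately show ?thesis
      by (simp only:)
  qed
  then have pos: "0 < h r0"
    by (simp add: h_def)
  have "continuous_on UNIV h"
    unfolding h_def by (intro continuous_intros continuous_on_compose2[OF g]) auto
  then have "(h \<longlongrightarrow> h r0) (at r0)"
    by (simp add: continuous_on_eq_continuous_at isCont_def)
  then have "\<forall>\<^sub>F r in at r0. 0 < h r"
    using pos by (rule order_tendstoD(1))
  then obtain e where e: "0 < e" "\<And>r. r \<noteq> r0 \<Longrightarrow> dist r r0 < e \<Longrightarrow> 0 < h r"
    by (auto simp: eventually_at)
  have "r0 < d"
    using y by (simp add: r0_def)
  define r where "r = r0 + min e (d - r0) / 2"
  have r: "r0 < r" "r < d" "dist r r0 < e"
    using e \<open>r0 < d\<close> by (auto simp: r_def dist_real_def min_def field_simps)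
  then have "0 < h r"
    using e by simp
  then have "g (c + r) - g (c - r) < a * (2 * r)"
    by (simp add: h_def)
  moreover have "x \<in> ball c r"
  proof -
    have "dist c x = r0"
      by (simp add: c_def r0_def dist_real_def field_simps abs_if)
    then show ?thesis using r by simp
  qed
  moreover note \<open>r < d\<close>
  ultimately show thesis using that by blast
qed

lemma small_ball_increment_greater:
  fixes g :: "real \<Rightarrow> real"
  assumes "continuous_on UNIV g"
    and "y \<noteq> x" "\<bar>y - x\<bar> < d" "a < (g y - g x) / (y - x)"
  obtains c r where "x \<in> ball c r" "r < d" "a * (2 * r) < g (c + r) - g (c - r)"
proof -
  have "((- g y) - (- g x)) / (y - x) < - a"
    using assms minus_divide_left[of "g y - g x" "y - x"] by simp
  then obtain c r where "x \<in> ball c r" "r < d" "- g (c + r) - - g (c - r) < - a * (2 * r)"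
    using small_ball_increment_less[of "\<lambda>x. - g x" y x d "- a"] assms
    by (auto intro: continuous_intros)
  then show thesis using that[of c r] by auto
qed

text \<open>A Vitali cover of \<open>S\<close> by balls of small increment, refined to one by balls of large increment,
  shrinks the outer measure of \<open>S\<close> by the factor \<open>a / b\<close>.\<close>

lemma negligible_two_slopes:
  fixes g :: "real \<Rightarrow> real"
  assumes g: "mono g" "continuous_on UNIV g" and ab: "0 \<le> a" "a < b" and S: "bounded S"
    and low: "\<And>x d. x \<in> S \<Longrightarrow> 0 < d \<Longrightarrow>
      \<exists>c r. x \<in> ball c r \<and> r < d \<and> g (c + r) - g (c - r) \<le> a * (2 * r)"
    and upp: "\<And>x d. x \<in> S \<Longrightarrow> 0 < d \<Longrightarrow>
      \<exists>c r. x \<in> ball c r \<and> r < d \<and> b * (2 * r) \<le> g (c + r) - g (c - r)"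
  shows "negligible S"
proof -
  define \<nu> where "\<nu> = interval_measure g"
  have \<nu>_ball: "emeasure \<nu> (ball c r) = ennreal (g (c + r) - g (c - r))" if "0 < r" for c r
    unfolding \<nu>_def by (rule emeasure_interval_measure_ball[OF g that])
  have lam_ball: "emeasure (scale_measure (ennreal s) lborel) (ball c r) = ennreal (s * (2 * r))"
    if "0 < r" "0 \<le> s" for s r and c :: real
    using that by (simp add: ball_eq_greaterThanLessThan emeasure_scale_measure ennreal_mult[symmetric])
  have [simp]: "sets \<nu> = sets borel"
    by (simp add: \<nu>_def)
  \<comment> \<open>\<open>S\<close> is not known to be measurable. The infimum \<open>m\<close> of
    \<open>Q\<close> is its outer measure, and the aim is \<open>m \<le> 0\<close>.\<close>
  define Q where "Q = {measure lebesgue T |T. T \<in> lmeasurable \<and> S \<subseteq> T}"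
  define m where "m = Inf Q"
  have bdd: "bdd_below Q"
    by (rule bdd_belowI[of _ 0]) (auto simp: Q_def)
  obtain s where "S \<subseteq> cbox (- s) s"
    using bounded_subset_cbox_symmetric[OF S] by blast
  then have ne: "Q \<noteq> {}"
    unfolding Q_def by (auto intro!: exI[of _ "cbox (- s) s"] simp del: cbox_interval)
  have shrink: "b * m \<le> a * (measure lebesgue T + e)"
    if T: "T \<in> lmeasurable" "S \<subseteq> T" and e: "0 < e" for T e
  proof -
    obtain W where W: "open W" "T \<subseteq> W" "W - T \<in> lmeasurable" "emeasure lebesgue (W - T) < ennreal e"
      using sets_lebesgue_outer_open[of T e] T e by (auto simp: fmeasurableD)
    then have "measure lebesgue (W - T) < e"
      using e by (simp add: emeasure_eq_measure2 ennreal_less_iff)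
    moreover have Wm: "W \<in> lmeasurable"
      using fmeasurable.Un[OF T(1) W(3)] W(2) by (simp add: Un_absorb1)
    ultimately have mW: "measure lebesgue W \<le> measure lebesgue T + e"
      using measurable_measure_Diff[OF Wm _ W(2)] T by (simp add: fmeasurableD)
    obtain U1 where U1: "open U1" "U1 \<subseteq> W" "negligible (S - U1)"
      "emeasure \<nu> U1 \<le> emeasure (scale_measure (ennreal a) lborel) U1"
    proof (rule Vitali_emeasure_le[of \<nu> "scale_measure (ennreal a) lborel" W S])
      fix x d assume "x \<in> S" "0 < (d::real)"
      then obtain c r where "x \<in> ball c r" "r < d" "g (c + r) - g (c - r) \<le> a * (2 * r)"
        using low by blast
      moreover from this have "0 < r"
        by (metis ball_eq_empty empty_iff not_le)
      ultimately show "\<exists>c r. x \<in> ball c r \<and> r < d \<and>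
          emeasure \<nu> (ball c r) \<le> emeasure (scale_measure (ennreal a) lborel) (ball c r)"
        using ab by - (rule exI[of _ c], rule exI[of _ r], simp add: \<nu>_ball lam_ball ennreal_leI del: emeasure_scale_measure)
    qed (use W T in auto)
    obtain U2 where U2: "open U2" "U2 \<subseteq> U1" "negligible (S \<inter> U1 - U2)"
      "emeasure (scale_measure (ennreal b) lborel) U2 \<le> emeasure \<nu> U2"
    proof (rule Vitali_emeasure_le[of "scale_measure (ennreal b) lborel" \<nu> U1 "S \<inter> U1"])
      fix x d assume "x \<in> S \<inter> U1" "0 < (d::real)"
      then obtain c r where "x \<in> ball c r" "r < d" "b * (2 * r) \<le> g (c + r) - g (c - r)"
        using upp by blast
      moreover from this have "0 < r"
        by (metis ball_eq_empty empty_iff not_le)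
      ultimately show "\<exists>c r. x \<in> ball c r \<and> r < d \<and>
          emeasure (scale_measure (ennreal b) lborel) (ball c r) \<le> emeasure \<nu> (ball c r)"
        using ab by - (rule exI[of _ c], rule exI[of _ r], simp add: \<nu>_ball lam_ball ennreal_leI del: emeasure_scale_measure)
    qed (use U1 in auto)
    have "emeasure (scale_measure (ennreal b) lborel) U2 \<le> emeasure \<nu> U1"
      using U2(4) emeasure_mono[OF U2(2), of \<nu>] U1(1) by (auto intro: order_trans)
    also have "\<dots> \<le> emeasure (scale_measure (ennreal a) lborel) W"
      using U1(4) emeasure_mono[OF U1(2), of "scale_measure (ennreal a) lborel"] W(1)
      by (intro order_trans[OF U1(4)]) simp
    finally have "ennreal b * emeasure lebesgue U2 \<le> ennreal a * emeasure lebesgue W"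
      using U2 W by (simp add: emeasure_scale_measure)
    moreover have "U2 \<in> lmeasurable"
      by (rule fmeasurableI2[OF Wm]) (use U1 U2 in \<open>auto intro: sets_completionI_sets\<close>)
    ultimately have mU2: "b * measure lebesgue U2 \<le> a * measure lebesgue W"
      using Wm ab by (simp add: emeasure_eq_measure2 ennreal_mult[symmetric])
    \<comment> \<open>The part of \<open>S\<close> missed by either covering is null, so
      \<open>U2\<close> enlarged by a null set still covers \<open>S\<close> and its measure
      competes in the infimum \<open>m\<close>.\<close>
    let ?T = "U2 \<union> ((S - U1) \<union> (S \<inter> U1 - U2))"
    have neg: "negligible ((S - U1) \<union> (S \<inter> U1 - U2))"
      using U1 U2 by (intro negligible_Un)
    have "?T \<in> lmeasurable"
      using \<open>U2 \<in> lmeasurable\<close> negligible_imp_measurable[OF neg] by (rule fmeasurable.Un)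
    moreover have "measure lebesgue ?T = measure lebesgue U2"
      using \<open>U2 \<in> lmeasurable\<close> neg
      by (intro measure_Un_null_set) (auto simp: negligible_iff_null_sets[symmetric] fmeasurableD)
    moreover have "S \<subseteq> ?T" by blast
    ultimately have "measure lebesgue U2 \<in> Q"
      unfolding Q_def by (metis (mono_tags, lifting) mem_Collect_eq)
    then have "m \<le> measure lebesgue U2"
      unfolding m_def using bdd by (rule cInf_lower)
    then have "b * m \<le> b * measure lebesgue U2"
      using ab by simp
    also have "\<dots> \<le> a * (measure lebesgue T + e)"
      using mU2 mW ab by (meson mult_left_mono order_trans)
    finally show ?thesis .
  qed
  have near: "\<exists>T. T \<in> lmeasurable \<and> S \<subseteq> T \<and> measure lebesgue T < m + e" if "0 < e" for e
    using cInf_lessD[OF ne, of "m + e"] that by (auto simp: Q_def m_def)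
  have "b * m \<le> a * m"
  proof (rule field_le_epsilon)
    fix e :: real assume e: "0 < e"
    \<comment> \<open>The error \<open>e'\<close> is spent twice, on \<open>T\<close> close to the
      infimum and on the open set close to \<open>T\<close>. Two of them make e / (a + 1), which
      stays below e after multiplication by a.\<close>
    define e' where "e' = e / (a + 1) / 2"
    have e': "0 < e'" using e ab by (simp add: e'_def)
    then obtain T where "T \<in> lmeasurable" "S \<subseteq> T" "measure lebesgue T < m + e'"
      using near by blast
    then have "b * m \<le> a * (measure lebesgue T + e')" "measure lebesgue T + e' \<le> m + e' + e'"
      using shrink[of T e'] e' by auto
    then have "b * m \<le> a * (m + e' + e')"
      using ab by (meson mult_left_mono order_trans)
    also have "\<dots> \<le> a * m + e"
    proof -
      have "e' + e' = e / (a + 1)"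
        unfolding e'_def by (rule field_sum_of_halves)
      then have "a * (m + e' + e') = a * m + a * e / (a + 1)"
        by (simp only: add.assoc distrib_left times_divide_eq_right)
      moreover have "a * e / (a + 1) \<le> e"
        using ab e by (simp add: divide_le_eq algebra_simps)
      ultimately show ?thesis by simp
    qed
    finally show "b * m \<le> a * m + e" .
  qed
  then have "m \<le> 0"
    using ab by (simp add: mult_le_cancel_right)
  then have "\<exists>T. S \<subseteq> T \<and> T \<in> lmeasurable \<and> measure lebesgue T < e" if "0 < e" for e
  proof -
    obtain T where T: "T \<in> lmeasurable" "S \<subseteq> T" "measure lebesgue T < m + e"
      using near[OF \<open>0 < e\<close>] by blast
    then have "measure lebesgue T < e"
      using \<open>m \<le> 0\<close> by linarith
    with T show ?thesis
      by blast
  qed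
  then show ?thesis
    unfolding negligible_outer by blast
qed

text \<open>A mean value inequality from an almost everywhere bound. For the monotone function f x +
  K x, small balls of slope below L + K + e cover almost all of the interval. What they miss is
  Lebesgue null and hence carries no increment. Removing K x and letting e tend to 0 leaves the
  slope L.\<close>

lemma lipschitz_increment_le_deriv_bound:
  fixes f :: "real \<Rightarrow> real"
  assumes lip: "K-lipschitz_on UNIV f" and N: "negligible N" and L: "0 \<le> L"
    and der: "\<And>x. x \<notin> N \<Longrightarrow> \<exists>D. (f has_real_derivative D) (at x) \<and> \<bar>D\<bar> \<le> L"
    and pq: "p < q"
  shows "f q - f p \<le> L * (q - p)"
proof -
  define g where "g = (\<lambda>x. f x + K * x)"
  define \<nu> where "\<nu> = interval_measure g"
  have K0: "0 \<le> K" using lip lipschitz_on_nonneg by blast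
  have glip: "(K + K)-lipschitz_on UNIV g"
    unfolding g_def using K0 by (intro lipschitz_on_add[OF lip]) (auto intro!: lipschitz_onI simp: dist_real_def right_diff_distrib[symmetric] abs_mult)
  have "mono g"
  proof (rule monoI)
    fix x y :: real assume "x \<le> y"
    then show "g x \<le> g y"
      using lipschitz_onD[OF lip, of x y] by (simp add: g_def dist_real_def abs_if algebra_simps split: if_splits)
  qed
  have cont: "continuous_on UNIV g"
    by (rule lipschitz_on_continuous_on[OF glip])
  have [simp]: "sets \<nu> = sets borel"
    by (simp add: \<nu>_def)
  have \<nu>_ball: "emeasure \<nu> (ball c r) = ennreal (g (c + r) - g (c - r))" if "0 < r" for c r
    unfolding \<nu>_def by (rule emeasure_interval_measure_ball[OF \<open>mono g\<close> cont that])
  have \<nu>_le: "emeasure \<nu> A \<le> ennreal (K + K) * emeasure lborel A" if "A \<in> sets borel" for A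
    using that \<open>mono g\<close> glip cont unfolding \<nu>_def
    by (intro emeasure_le_lborel_of_lipschitz[of _ g] emeasure_interval_measure_Ioc)
      (auto simp: mono_def continuous_on_eq_continuous_at continuous_at_imp_continuous_at_within)
  have g_le: "g q - g p \<le> (L + K + e) * (q - p)" if e: "0 < e" for e
  proof -
    let ?s = "L + K + e"
    have s0: "0 \<le> ?s" using L K0 e by simp
    obtain U where U: "open U" "U \<subseteq> {p<..<q}" "negligible (({p<..<q} - N) - U)"
      "emeasure \<nu> U \<le> emeasure (scale_measure (ennreal ?s) lborel) U"
    proof (rule Vitali_emeasure_le[of \<nu> "scale_measure (ennreal ?s) lborel" "{p<..<q}" "{p<..<q} - N"])
      fix x d assume x: "x \<in> {p<..<q} - N" and d: "0 < (d::real)"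
      then obtain D where D: "(f has_real_derivative D) (at x)" "\<bar>D\<bar> \<le> L"
        using der by blast
      have "(g has_real_derivative D + K) (at x)"
        unfolding g_def by (auto intro!: derivative_eq_intros D)
      then have "\<forall>\<^sub>F y in at x. (g y - g x) / (y - x) < ?s"
        using D e by (intro order_tendstoD(2)) (auto simp: has_field_derivative_iff)
      moreover have "\<forall>\<^sub>F y in at x. y \<noteq> x \<and> \<bar>y - x\<bar> < d"
        using d by (auto simp: eventually_at dist_real_def)
      ultimately have "\<forall>\<^sub>F y in at x. y \<noteq> x \<and> \<bar>y - x\<bar> < d \<and> (g y - g x) / (y - x) < ?s"
        by eventually_elim auto
      then obtain y where "y \<noteq> x" "\<bar>y - x\<bar> < d" "(g y - g x) / (y - x) < ?s"
        using eventually_happens[of _ "at x"] by force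
      then obtain c r where cr: "x \<in> ball c r" "r < d" "g (c + r) - g (c - r) < ?s * (2 * r)"
        using small_ball_increment_less[OF cont] by metis
      then have r: "0 < r"
        by (metis ball_eq_empty empty_iff not_le)
      have "emeasure (scale_measure (ennreal ?s) lborel) (ball c r) = ennreal (?s * (2 * r))"
        using r s0 by (simp add: ball_eq_greaterThanLessThan emeasure_scale_measure ennreal_mult[symmetric] del: ennreal_plus)
      then show "\<exists>c r. x \<in> ball c r \<and> r < d \<and>
          emeasure \<nu> (ball c r) \<le> emeasure (scale_measure (ennreal ?s) lborel) (ball c r)"
        using cr r by - (rule exI[of _ c], rule exI[of _ r], simp add: \<nu>_ball ennreal_leI del: ennreal_plus emeasure_scale_measure)
    qed auto
    have "negligible ({p<..<q} - U)"
      by (rule negligible_subset[OF negligible_Un[OF U(3) N]]) blast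
    moreover have [measurable]: "U \<in> sets borel" using U by simp
    ultimately have "emeasure lborel ({p<..<q} - U) = 0"
      by (simp add: negligible_iff_null_sets null_sets_def)
    \<comment> \<open>Here the Lipschitz property of f acts as absolute continuity: it excludes
      growth concentrated on a null set, as in the Cantor function.\<close>
    then have "emeasure \<nu> ({p<..<q} - U) = 0"
      using \<nu>_le[of "{p<..<q} - U"] by simp
    moreover have "emeasure \<nu> {p<..<q} = emeasure \<nu> U + emeasure \<nu> ({p<..<q} - U)"
      using U by (subst plus_emeasure) (auto intro!: arg_cong[where f = "emeasure \<nu>"])
    ultimately have "emeasure \<nu> {p<..<q} \<le> ennreal ?s * emeasure lborel {p<..<q}"
      using U(4) mult_left_mono[OF emeasure_mono[OF U(2)], of lborel "ennreal ?s"]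
      by (simp add: emeasure_scale_measure del: ennreal_plus)
    moreover have "{p<..<q} = ball ((p + q) / 2) ((q - p) / 2)"
      by (simp add: ball_eq_greaterThanLessThan field_simps)
    then have "emeasure \<nu> {p<..<q} = ennreal (g q - g p)"
      using pq \<nu>_ball[of "(q - p) / 2" "(p + q) / 2"] by (simp add: field_simps)
    ultimately have "ennreal (g q - g p) \<le> ennreal (?s * (q - p))"
      using pq s0 by (simp add: ennreal_mult[symmetric] del: ennreal_plus)
    then show ?thesis
      using pq s0 by (subst (asm) ennreal_le_iff) auto
  qed
  have f_le: "f q - f p \<le> (L + e) * (q - p)" if "0 < e" for e
    using g_le[OF that] by (simp add: g_def algebra_simps)
  have "f q - f p \<le> L * (q - p) + e" if "0 < e" for e
  proof -
    have "0 < e / (q - p)" using that pq by simp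
    then have "f q - f p \<le> (L + e / (q - p)) * (q - p)" by (rule f_le)
    also have "\<dots> = L * (q - p) + e" using pq by (simp add: distrib_right)
    finally show ?thesis .
  qed
  then show ?thesis
    by (rule field_le_epsilon)
qed

text \<open>The difference quotients are bounded, so differentiability fails only where their lower
  and upper limits differ, and then two rationals separate these limits. For each pair of rationals
  the points of bounded modulus form a null set by the two-slope argument, and there are countably
  many choices. Adding K x makes the function monotone and puts the quotients in [0, 2 K], so the
  rationals can be taken nonnegative.\<close>

lemma lipschitz_imp_negligible_nondifferentiable:
  fixes f :: "real \<Rightarrow> real"
  assumes lip: "K-lipschitz_on UNIV f"
  shows "negligible {x. \<not> f differentiable at x}"
proof -
  define g where "g = (\<lambda>x. f x + K * x)"
  define q where "q = (\<lambda>x y. (g y - g x) / (y - x))"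
  have f_inc: "\<bar>f x - f y\<bar> \<le> K * \<bar>x - y\<bar>" for x y
    using lipschitz_onD[OF lip, of x y] by (simp add: dist_real_def)
  have "mono g"
  proof (rule monoI)
    fix x y :: real assume "x \<le> y"
    then show "g x \<le> g y"
      using f_inc[of x y] by (simp add: g_def abs_if algebra_simps split: if_splits)
  qed
  have cont: "continuous_on UNIV g"
    unfolding g_def by (intro continuous_intros lipschitz_on_continuous_on[OF lip])
  have q_eq: "q x y = (f y - f x) / (y - x) + K" if "x \<noteq> y" for x y
    using that by (simp add: q_def g_def field_simps)
  have abs_le: "\<bar>(f y - f x) / (y - x)\<bar> \<le> K" if "x \<noteq> y" for x y
    using f_inc[of y x] that by (simp add: abs_divide divide_le_eq)
  have q_bounds: "0 \<le> q x y" "q x y \<le> 2 * K" if "x \<noteq> y" for x y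
    using abs_le[OF that] q_eq[OF that] by (simp_all only: abs_le_iff) linarith+
  define S where "S = (\<lambda>(a::rat, b::rat, n::nat). {x. \<bar>x\<bar> \<le> real n \<and> 0 \<le> a \<and> a < b \<and>
     (\<exists>\<^sub>F y in at x. q x y < of_rat a) \<and> (\<exists>\<^sub>F y in at x. of_rat b < q x y)})"
  have "negligible (S i)" for i
  proof -
    obtain a b n where i: "i = (a, b, n)" by (cases i)
    show ?thesis
    proof (cases "0 \<le> a \<and> a < b")
      case True
      have near: "\<exists>y. y \<noteq> x \<and> \<bar>y - x\<bar> < d \<and> P y" if "\<exists>\<^sub>F y in at x. P y" "0 < d" for x d :: real and P
        using that by (auto simp: frequently_def eventually_at dist_real_def)
      show ?thesis
      proof (rule negligible_two_slopes[OF \<open>mono g\<close> cont, of "of_rat a" "of_rat b"])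
        show "bounded (S i)"
          by (rule boundedI[of _ "real n"]) (auto simp: S_def i)
      next
        fix x d assume "x \<in> S i" "0 < (d::real)"
        then obtain y where "y \<noteq> x" "\<bar>y - x\<bar> < d" "(g y - g x) / (y - x) < of_rat a"
          using near[where x = x and d = d and P = "\<lambda>y. q x y < of_rat a"] by (auto simp: S_def i q_def)
        then show "\<exists>c r. x \<in> ball c r \<and> r < d \<and> g (c + r) - g (c - r) \<le> of_rat a * (2 * r)"
          using small_ball_increment_less[OF cont] by (metis less_imp_le)
      next
        fix x d assume "x \<in> S i" "0 < (d::real)"
        then obtain y where "y \<noteq> x" "\<bar>y - x\<bar> < d" "of_rat b < (g y - g x) / (y - x)"
          using near[where x = x and d = d and P = "\<lambda>y. of_rat b < q x y"] by (auto simp: S_def i q_def)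
        then show "\<exists>c r. x \<in> ball c r \<and> r < d \<and> of_rat b * (2 * r) \<le> g (c + r) - g (c - r)"
          using small_ball_increment_greater[OF cont] by (metis less_imp_le)
      qed (use True in \<open>auto simp: of_rat_less\<close>)
    qed (auto simp: S_def i)
  qed
  then have "negligible (\<Union>i. S i)"
    by (intro negligible_countable_Union) auto
  moreover have "{x. \<not> f differentiable at x} \<subseteq> (\<Union>i. S i)"
  proof (rule subsetI, rule ccontr)
    fix x assume x: "x \<in> {x. \<not> f differentiable at x}" "x \<notin> (\<Union>i. S i)"
    define I where "I = Liminf (at x) (\<lambda>y. ereal (q x y))"
    define J where "J = Limsup (at x) (\<lambda>y. ereal (q x y))"
    have I0: "0 \<le> I"
      unfolding I_def by (rule Liminf_bounded) (auto simp: eventually_at_filter q_bounds)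
    have J_le: "J \<le> ereal (2 * K)"
      unfolding J_def by (rule Limsup_bounded) (auto simp: eventually_at_filter q_bounds)
    have IJ: "I \<le> J"
      unfolding I_def J_def by (rule Liminf_le_Limsup) simp
    have "I = J"
    proof (rule ccontr)
      assume "I \<noteq> J"
      then have "I < J" using IJ by simp
      then obtain b where b: "I < ereal (of_rat b)" "ereal (of_rat b) < J"
        using ereal_dense3 by blast
      then obtain a where a: "I < ereal (of_rat a)" "ereal (of_rat a) < ereal (of_rat b)"
        using ereal_dense3 by blast
      have "0 < ereal (of_rat a)" using I0 a(1) by (rule le_less_trans)
      then have ab: "0 \<le> a" "a < b" using a by (auto simp: of_rat_less)
      have "\<exists>\<^sub>F y in at x. q x y < of_rat a"
      proof (rule ccontr)
        assume "\<not> (\<exists>\<^sub>F y in at x. q x y < of_rat a)"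
        then have "ereal (of_rat a) \<le> I"
          unfolding I_def by (intro Liminf_bounded) (simp add: frequently_def not_less)
        then show False using a by simp
      qed
      moreover have "\<exists>\<^sub>F y in at x. of_rat b < q x y"
      proof (rule ccontr)
        assume "\<not> (\<exists>\<^sub>F y in at x. of_rat b < q x y)"
        then have "J \<le> ereal (of_rat b)"
          unfolding J_def by (intro Limsup_bounded) (simp add: frequently_def not_less)
        then show False using b by simp
      qed
      moreover obtain n :: nat where "\<bar>x\<bar> \<le> real n"
        using real_arch_simple by blast
      ultimately have "x \<in> S (a, b, n)"
        using ab by (simp add: S_def)
      then show False using x by blast
    qed
    then obtain l where l: "I = ereal l" "J = ereal l"
      using I0 J_le by (cases I) auto
    then have "((\<lambda>y. ereal (q x y)) \<longlongrightarrow> ereal l) (at x)"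
      unfolding I_def J_def by (intro Liminf_eq_Limsup) simp_all
    then have "(q x \<longlongrightarrow> l) (at x)"
      by simp
    then have "((\<lambda>y. q x y - K) \<longlongrightarrow> l - K) (at x)"
      by (intro tendsto_intros)
    then have "((\<lambda>y. (f y - f x) / (y - x)) \<longlongrightarrow> l - K) (at x)"
      by (rule Lim_transform_eventually) (auto simp: eventually_at_filter q_eq)
    then have "(f has_real_derivative l - K) (at x)"
      by (simp add: has_field_derivative_iff)
    then show False
      using x by (auto simp: real_differentiable_def)
  qed
  ultimately show ?thesis
    by (rule negligible_subset)
qed

section \<open>The essential bound of the derivative as a Lipschitz constant\<close>

lemma periodic_fun_simple'_iff: "periodic_fun_simple' u \<longleftrightarrow> (\<forall>x. u (x + 1) = u x)"
  by (simp add: periodic_fun_simple'_def periodic_fun_simple_def periodic_fun_def)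

text \<open>Periodicity spreads the essential bound from one period to the line outside a null set.
  The increment estimate, applied to \<open>b\<close> and to its negative, then turns it into a
  two-sided Lipschitz bound.\<close>

lemma lipschitz_Linf_deriv:
  fixes b :: "real \<Rightarrow> real"
  assumes lip: "K-lipschitz_on UNIV b" and per: "periodic_fun_simple' b"
  shows "(Linf_deriv b)-lipschitz_on UNIV b"
proof -
  interpret b: periodic_fun_simple' b by (rule per)
  have K0: "0 \<le> K" using lip lipschitz_on_nonneg by blast
  define Z where "Z = {x. \<not> b differentiable at x}"
  have Z: "negligible Z"
    unfolding Z_def by (rule lipschitz_imp_negligible_nondifferentiable[OF lip])
  have der: "(b has_real_derivative deriv b x) (at x)" if "x \<notin> Z" for x
    using that by (auto simp: Z_def DERIV_deriv_iff_real_differentiable)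
  have quot: "((\<lambda>h. (b (x + h) - b x) / h) \<longlongrightarrow> deriv b x) (at 0)" if "x \<notin> Z" for x
    using der[OF that] by (simp add: DERIV_def)
  have AE_Z: "AE x in lebesgue. x \<notin> Z"
    using Z by (simp add: negligible_iff_null_sets AE_not_in)
  have "deriv b \<in> borel_measurable lebesgue"
  proof (rule borel_measurable_AE)
    \<comment> \<open>Forward difference quotients of the continuous \<open>b\<close> converge to
      \<open>deriv b\<close> wherever the derivative exists. Elsewhere \<open>deriv b\<close> is
      arbitrary, which Lebesgue measurability tolerates.\<close>
    define F where "F = (\<lambda>n x. (b (x + 1 / real (Suc n)) - b x) / (1 / real (Suc n)))"
    have "F n \<in> borel_measurable borel" for n
      unfolding F_def
      by (intro borel_measurable_continuous_onI continuous_intros continuous_on_compose2[OF lipschitz_on_continuous_on[OF lip]]) auto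
    then have "F n \<in> borel_measurable lebesgue" for n
      by (intro measurable_completion) simp
    then show "(\<lambda>x. lim (\<lambda>n. F n x)) \<in> borel_measurable lebesgue"
      by (rule borel_measurable_lim_metric)
    show "AE x in lebesgue. lim (\<lambda>n. F n x) = deriv b x"
      using AE_Z
    proof eventually_elim
      case (elim x)
      have "filterlim (\<lambda>n. 1 / real (Suc n)) (at 0) sequentially"
        unfolding filterlim_at using LIMSEQ_inverse_real_of_nat by (auto simp: inverse_eq_divide)
      then have "(\<lambda>n. F n x) \<longlonglongrightarrow> deriv b x"
        unfolding F_def by (rule filterlim_compose[OF quot[OF elim]])
      then show ?case by (rule limI)
    qed
  qed
  then have meas: "(\<lambda>x. ereal \<bar>deriv b x\<bar>) \<in> borel_measurable (lebesgue_on Omega)"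
    by (intro borel_measurable_ereal borel_measurable_abs measurable_restrict_space1)
  define L where "L = Linf_deriv b"
  define E where "E = esssup (lebesgue_on Omega) (\<lambda>x. ereal \<bar>deriv b x\<bar>)"
  have Om: "Omega \<in> sets lebesgue" by (simp add: Omega_def)
  have der_le: "\<bar>deriv b x\<bar> \<le> K" if "x \<notin> Z" for x
  proof (rule tendsto_upperbound)
    show "((\<lambda>h. \<bar>(b (x + h) - b x) / h\<bar>) \<longlongrightarrow> \<bar>deriv b x\<bar>) (at 0)"
      by (intro tendsto_intros quot[OF that])
    show "\<forall>\<^sub>F h in at 0. \<bar>(b (x + h) - b x) / h\<bar> \<le> K"
      using lipschitz_onD[OF lip, of "x + _" x]
      by (auto simp: eventually_at_filter abs_divide divide_le_eq dist_real_def)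
  qed simp
  \<comment> \<open>\<open>real_of_ereal\<close> sends both infinities to 0, so \<open>E\<close> has
    to be confined between 0 and K before \<open>L\<close> can stand for its value.\<close>
  have "E \<le> ereal K"
    unfolding E_def
  proof (rule esssup_I[OF meas])
    show "AE x in lebesgue_on Omega. ereal \<bar>deriv b x\<bar> \<le> ereal K"
      using AE_Z Om by (auto simp: AE_restrict_space_iff der_le)
  qed
  moreover have "0 \<le> E"
  proof -
    have "emeasure (lebesgue_on Omega) (space (lebesgue_on Omega)) \<noteq> 0"
      by (simp add: Omega_def emeasure_restrict_space)
    then have "esssup (lebesgue_on Omega) (\<lambda>x. 0 :: ereal) = 0"
      by (rule esssup_const)
    moreover have "esssup (lebesgue_on Omega) (\<lambda>x. 0 :: ereal) \<le> E"
      unfolding E_def by (rule esssup_mono) (auto simp: meas)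
    ultimately show ?thesis by simp
  qed
  ultimately have L: "E = ereal L" "0 \<le> L"
    unfolding L_def Linf_deriv_def E_def[symmetric] by (cases E; simp)+
  have "AE x in lebesgue_on Omega. \<bar>deriv b x\<bar> \<le> L"
    using esssup_AE[of "\<lambda>x. ereal \<bar>deriv b x\<bar>" "lebesgue_on Omega"] L by (simp add: E_def[symmetric])
  then have "AE x in lebesgue. x \<in> Omega \<longrightarrow> \<bar>deriv b x\<bar> \<le> L"
    using Om by (simp add: AE_restrict_space_iff)
  then obtain Y where Y: "negligible Y" "{x. \<not> (x \<in> Omega \<longrightarrow> \<bar>deriv b x\<bar> \<le> L)} \<subseteq> Y"
    by (auto simp: eventually_ae_filter negligible_iff_null_sets)
  \<comment> \<open>Besides the points of nondifferentiability and all integer translates of the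
    exceptional set in \<open>Omega\<close>, the integers are discarded, because their fractional
    part 0 lies outside \<open>Omega\<close>.\<close>
  define N where "N = Z \<union> (\<Union>j. insert (real_of_int j) ((+) (real_of_int j) ` Y))"
  have "negligible N"
    unfolding N_def using Z Y
    by (intro negligible_Un negligible_countable_Union negligible_translation) (auto simp: negligible_insert negligible_translation)
  have bdd_der: "\<exists>D. (b has_real_derivative D) (at x) \<and> \<bar>D\<bar> \<le> L" if "x \<notin> N" for x
  proof -
    have "x \<notin> Z" using that by (simp add: N_def)
    note d = der[OF this]
    have "frac x \<in> Omega"
      using that by (auto simp: Omega_def N_def frac_lt_1 Ints_def)
    moreover have "frac x \<notin> Y"
    proof
      assume "frac x \<in> Y"
      then have "of_int \<lfloor>x\<rfloor> + frac x \<in> (\<Union>j. (+) (real_of_int j) ` Y)" by blast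
      then show False using that by (simp add: N_def frac_def)
    qed
    ultimately have "\<bar>deriv b (frac x)\<bar> \<le> L" using Y by blast
    moreover have "(b has_real_derivative deriv b x) (at (frac x))"
    proof -
      have "((\<lambda>z. b (z + of_int \<lfloor>x\<rfloor>)) has_real_derivative deriv b x) (at (frac x))"
        using d by (subst DERIV_shift[symmetric]) (simp add: frac_def)
      then show ?thesis by (simp add: b.plus_of_int)
    qed
    then have "deriv b (frac x) = deriv b x"
      by (rule DERIV_imp_deriv)
    ultimately show ?thesis using d by auto
  qed
  have inc: "f q - f p \<le> L * (q - p)" if "p < q" "f = b \<or> f = (\<lambda>x. - b x)" for p q f
  proof -
    have *: "K-lipschitz_on UNIV f" using lip that(2) by auto
    show ?thesis
    proof (rule lipschitz_increment_le_deriv_bound[OF * \<open>negligible N\<close> L(2) _ that(1)])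
      fix x assume "x \<notin> N"
      then obtain D where "(b has_real_derivative D) (at x)" "\<bar>D\<bar> \<le> L"
        using bdd_der by blast
      then show "\<exists>D. (f has_real_derivative D) (at x) \<and> \<bar>D\<bar> \<le> L"
        using that(2) by (auto intro: exI[of _ "- D"] derivative_intros)
    qed
  qed
  have abs_inc: "\<bar>b q - b p\<bar> \<le> L * (q - p)" if "p < q" for p q
    using inc[of p q b] inc[of p q "\<lambda>x. - b x"] that by auto
  have "dist (b p) (b q) \<le> L * dist p q" for p q
    using abs_inc[of p q] abs_inc[of q p]
    by (cases p q rule: linorder_cases) (auto simp: dist_real_def abs_minus_commute)
  then show ?thesis
    unfolding L_def[symmetric] using L by (intro lipschitz_onI)
qed

section \<open>The flow of a Lipschitz periodic field\<close>

text \<open>The preimage of (a, b] under \<Phi> is (\<psi> a, \<psi> b], so the image of Lebesgue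
  measure under \<Phi> is the Stieltjes measure of the Lipschitz function \<psi>, at most C times
  Lebesgue measure. In particular preimages of null sets are null, which is what measurability for
  the completed measure requires beyond the Borel case.\<close>

lemma lebesgue_compose_lipschitz_inverse:
  fixes \<Phi> \<psi> :: "real \<Rightarrow> real"
  assumes inv: "\<And>x. \<Phi> (\<psi> x) = x" "\<And>x. \<psi> (\<Phi> x) = x"
    and mono: "mono \<Phi>" "mono \<psi>" and lip: "C-lipschitz_on UNIV \<psi>"
  shows measurable_lebesgue_lipschitz_inverse: "\<Phi> \<in> lebesgue \<rightarrow>\<^sub>M lebesgue"
    and nn_integral_compose_lipschitz_inverse: "W \<in> borel_measurable lebesgue \<Longrightarrow>
      (\<integral>\<^sup>+x. W (\<Phi> x) \<partial>lebesgue) \<le> ennreal C * (\<integral>\<^sup>+x. W x \<partial>lebesgue)"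
proof -
  have \<Phi>_borel [measurable]: "\<Phi> \<in> borel_measurable borel"
    by (rule borel_measurable_mono[OF mono(1)])
  have le: "emeasure lborel (\<Phi> -` A) \<le> ennreal C * emeasure lborel A" if A: "A \<in> sets borel" for A
  proof -
    have "emeasure (distr lborel borel \<Phi>) A \<le> ennreal C * emeasure lborel A"
    proof (rule emeasure_le_lborel_of_lipschitz[OF _ _ mono(2) lip A])
      fix a b :: real assume "a \<le> b"
      have "\<Phi> -` {a<..b} = {\<psi> a<..\<psi> b}"
        using inv mono by (auto simp: mono_def not_le[symmetric]) metis+
      then show "emeasure (distr lborel borel \<Phi>) {a<..b} = ennreal (\<psi> b - \<psi> a)"
        using monoD[OF mono(2) \<open>a \<le> b\<close>] by (simp add: emeasure_distr)
    qed simp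
    then show ?thesis using A by (simp add: emeasure_distr)
  qed
  have \<Phi>_leb: "\<Phi> \<in> lebesgue \<rightarrow>\<^sub>M lborel"
    by (intro measurable_completion) simp
  show meas: "\<Phi> \<in> lebesgue \<rightarrow>\<^sub>M lebesgue"
  proof (rule completion.measurable_completion2[OF \<Phi>_leb], rule subsetI)
    fix A :: "real set" assume "A \<in> null_sets lborel"
    then have "A \<in> sets borel" "emeasure lborel A = 0" by auto
    then show "A \<in> null_sets (distr lebesgue lborel \<Phi>)"
      using le[of A] \<Phi>_leb measurable_sets[OF \<Phi>_borel, of A] by (simp add: null_sets_def emeasure_distr)
  qed
  have D_le: "distr lebesgue lebesgue \<Phi> \<le> scale_measure (ennreal C) lebesgue"
  proof (subst le_measure)
    show "\<forall>A\<in>sets (distr lebesgue lebesgue \<Phi>).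
        emeasure (distr lebesgue lebesgue \<Phi>) A \<le> emeasure (scale_measure (ennreal C) lebesgue) A"
    proof
      fix A assume "A \<in> sets (distr lebesgue lebesgue \<Phi>)"
      then have A: "A \<in> sets lebesgue" by simp
      obtain A' where A': "A' \<in> sets borel" "A \<subseteq> A'" "emeasure lebesgue A = emeasure lborel A'"
        using completion_upper[OF A] by auto
      have "emeasure (distr lebesgue lebesgue \<Phi>) A \<le> emeasure (distr lebesgue lebesgue \<Phi>) A'"
        using A' by (intro emeasure_mono) auto
      also have "\<dots> = emeasure lborel (\<Phi> -` A')"
        using A' meas measurable_sets[OF \<Phi>_borel, of A'] by (simp add: emeasure_distr)
      also have "\<dots> \<le> ennreal C * emeasure lebesgue A"
        using le A' by simp
      finally show "emeasure (distr lebesgue lebesgue \<Phi>) A \<le> emeasure (scale_measure (ennreal C) lebesgue) A"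
        by simp
    qed
  qed simp
  show "(\<integral>\<^sup>+x. W (\<Phi> x) \<partial>lebesgue) \<le> ennreal C * (\<integral>\<^sup>+x. W x \<partial>lebesgue)"
    if W: "W \<in> borel_measurable lebesgue"
  proof -
    have "(\<integral>\<^sup>+x. W (\<Phi> x) \<partial>lebesgue) = (\<integral>\<^sup>+x. W x \<partial>distr lebesgue lebesgue \<Phi>)"
      using W meas by (simp add: nn_integral_distr)
    also have "\<dots> \<le> (\<integral>\<^sup>+x. W x \<partial>scale_measure (ennreal C) lebesgue)"
      using D_le by (intro nn_integral_mono_measure) simp_all
    also have "\<dots> = ennreal C * (\<integral>\<^sup>+x. W x \<partial>lebesgue)"
      using W by (intro nn_integral_scale_measure)
    finally show ?thesis .
  qed
qed

section \<open>Translations and periodic functions\<close>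

lemma lebesgue_shift:
  fixes c :: real
  shows measurable_lebesgue_shift: "(\<lambda>x. x - c) \<in> lebesgue \<rightarrow>\<^sub>M lebesgue"
    and nn_integral_shift_le: "W \<in> borel_measurable lebesgue \<Longrightarrow>
      (\<integral>\<^sup>+x. W (x - c) \<partial>lebesgue) \<le> (\<integral>\<^sup>+x. W x \<partial>lebesgue)"
proof -
  have lip: "1-lipschitz_on UNIV (\<lambda>x. x + c)"
    by (rule lipschitz_onI) (auto simp: dist_real_def)
  show "(\<lambda>x. x - c) \<in> lebesgue \<rightarrow>\<^sub>M lebesgue"
    by (rule measurable_lebesgue_lipschitz_inverse[OF _ _ _ _ lip]) (auto simp: mono_def)
  show "(\<integral>\<^sup>+x. W (x - c) \<partial>lebesgue) \<le> (\<integral>\<^sup>+x. W x \<partial>lebesgue)" if "W \<in> borel_measurable lebesgue"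
    using nn_integral_compose_lipschitz_inverse[OF _ _ _ _ lip that, of "\<lambda>x. x - c"]
    by (simp add: mono_def)
qed

lemma borel_measurable_periodic:
  fixes u :: "real \<Rightarrow> real"
  assumes per: "periodic_fun_simple' u" and u: "u \<in> borel_measurable (lebesgue_on Omega)"
  shows "u \<in> borel_measurable lebesgue"
proof -
  interpret u: periodic_fun_simple' u by (rule per)
  \<comment> \<open>\<open>Omega\<close> does not contain 0, the fractional part of every integer.
    The default value \<open>u 0\<close> makes \<open>v\<close> agree with \<open>u\<close> there as
    well.\<close>
  define v where "v = (\<lambda>x. if x \<in> Omega then u x else u 0)"
  have v: "v \<in> borel_measurable lebesgue"
    unfolding v_def using u by (subst measurable_restrict_space_iff[symmetric]) (auto simp: Omega_def)
  have "(\<lambda>x. v (x - real_of_int \<lfloor>x\<rfloor>)) \<in> borel_measurable lebesgue"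
  proof (rule measurable_compose_countable[where g = floor and f = "\<lambda>i x. v (x - real_of_int i)"])
    show "(\<lambda>x. v (x - real_of_int i)) \<in> borel_measurable lebesgue" for i
      by (rule measurable_compose[OF measurable_lebesgue_shift v])
    show "(floor :: real \<Rightarrow> int) \<in> lebesgue \<rightarrow>\<^sub>M count_space UNIV"
      by (intro measurable_completion) (simp add: measurable_real_floor)
  qed
  moreover have "v (x - real_of_int \<lfloor>x\<rfloor>) = u x" for x
  proof -
    have "u (x - real_of_int \<lfloor>x\<rfloor>) = u x" by (rule u.minus_of_int)
    moreover have "x - real_of_int \<lfloor>x\<rfloor> = 0 \<or> x - real_of_int \<lfloor>x\<rfloor> \<in> Omega"
      unfolding Omega_def by (simp add: frac_def[symmetric] frac_lt_1 frac_ge_0 order.order_iff_strict)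
    ultimately show ?thesis by (auto simp: v_def)
  qed
  ultimately show ?thesis by simp
qed

text \<open>The window is cut at the only integer that can lie inside it, and integer shifts move
  the two pieces to disjoint parts of (0, 1]. The point 1 is null.\<close>

lemma nn_integral_period_le:
  fixes W :: "real \<Rightarrow> ennreal"
  assumes per: "periodic_fun_simple' W" and W: "W \<in> borel_measurable lebesgue"
  shows "(\<integral>\<^sup>+x. W x * indicator {c<..<c + 1} x \<partial>lebesgue) \<le> (\<integral>\<^sup>+x. W x * indicator Omega x \<partial>lebesgue)"
proof -
  interpret W: periodic_fun_simple' W by (rule per)
  define n where "n = \<lfloor>c\<rfloor>"
  define d where "d = c - real_of_int n"
  have d: "0 \<le> d" "d < 1" "c = real_of_int n + d"
    unfolding d_def n_def by linarith+
  have [measurable]: "{a<..b} \<in> sets lebesgue" for a b :: real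
    by simp
  note W[measurable]
  have shift: "(\<integral>\<^sup>+x. W x * indicator {a<..b} x \<partial>lebesgue) \<le>
      (\<integral>\<^sup>+x. W x * indicator {a - real_of_int m<..b - real_of_int m} x \<partial>lebesgue)" for a b m
  proof -
    have "(\<integral>\<^sup>+x. W x * indicator {a<..b} x \<partial>lebesgue) = (\<integral>\<^sup>+x. W (x - real_of_int m) *
        indicator {a - real_of_int m<..b - real_of_int m} (x - real_of_int m) \<partial>lebesgue)"
      by (intro nn_integral_cong) (auto simp: W.minus_of_int indicator_def)
    also have "\<dots> \<le> (\<integral>\<^sup>+x. W x * indicator {a - real_of_int m<..b - real_of_int m} x \<partial>lebesgue)"
      by (rule nn_integral_shift_le[where W = "\<lambda>x. W x * indicator {a - real_of_int m<..b - real_of_int m} x"]) measurable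
    finally show ?thesis .
  qed
  have "(\<integral>\<^sup>+x. W x * indicator {c<..<c + 1} x \<partial>lebesgue) \<le>
      (\<integral>\<^sup>+x. W x * indicator {c<..real_of_int n + 1} x + W x * indicator {real_of_int n + 1<..c + 1} x \<partial>lebesgue)"
    using d by (intro nn_integral_mono) (auto simp: indicator_def)
  also have "\<dots> = (\<integral>\<^sup>+x. W x * indicator {c<..real_of_int n + 1} x \<partial>lebesgue) +
      (\<integral>\<^sup>+x. W x * indicator {real_of_int n + 1<..c + 1} x \<partial>lebesgue)"
    by (intro nn_integral_add) measurable
  also have "\<dots> \<le> (\<integral>\<^sup>+x. W x * indicator {d<..1} x \<partial>lebesgue) + (\<integral>\<^sup>+x. W x * indicator {0<..d} x \<partial>lebesgue)"
    using shift[of c "real_of_int n + 1" n] shift[of "real_of_int n + 1" "c + 1" "n + 1"]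
    by (intro add_mono) (simp_all add: d_def)
  also have "\<dots> = (\<integral>\<^sup>+x. W x * indicator {d<..1} x + W x * indicator {0<..d} x \<partial>lebesgue)"
    by (intro nn_integral_add[symmetric]) measurable
  also have "\<dots> \<le> (\<integral>\<^sup>+x. W x * indicator Omega x \<partial>lebesgue)"
  proof (rule nn_integral_mono_AE)
    have "AE x in lebesgue. x \<noteq> (1::real)"
      by (intro AE_completion AE_lborel_singleton)
    then show "AE x in lebesgue. W x * indicator {d<..1} x + W x * indicator {0<..d} x \<le> W x * indicator Omega x"
      by eventually_elim (use d in \<open>auto simp: indicator_def Omega_def\<close>)
  qed
  finally show ?thesis .
qed

text \<open>The constant \<open>K\<close> is a parameter because the flow is used with two of them:
  the essential bound of the derivative in (i), and any Lipschitz constant of \<open>b\<close> for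
  the scheme.\<close>

locale lipschitz_flow =
  fixes b :: "real \<Rightarrow> real" and y :: "real \<Rightarrow> real \<Rightarrow> real" and K :: real
  assumes lipschitz: "K-lipschitz_on UNIV b"
    and periodic: "periodic_fun_simple' b"
    and char: "characteristics b y"
begin

sublocale b: periodic_fun_simple' b
  by (rule periodic)

lemma flow_0: "y x 0 = x"
  and flow_deriv: "(y x has_real_derivative b (y x t)) (at t)"
  using char by (simp_all add: characteristics_def)

lemma K_nonneg: "0 \<le> K"
  using lipschitz lipschitz_on_nonneg by blast

text \<open>Gronwall's argument for the squared distance \<open>D\<close>, which unlike the distance
  is differentiable: |D'| is at most 2 K D, so an exponential weight of suitable sign makes it
  monotone on each side of time 0. Stated for arbitrary solutions, the bound yields uniqueness as
  well as dependence on the starting point.\<close>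

lemma solutions_distance:
  assumes z1: "\<And>t. (z1 has_real_derivative b (z1 t)) (at t)"
    and z2: "\<And>t. (z2 has_real_derivative b (z2 t)) (at t)"
  shows "\<bar>z1 t - z2 t\<bar> \<le> exp (K * \<bar>t\<bar>) * \<bar>z1 0 - z2 0\<bar>"
proof -
  define D where "D = (\<lambda>t. (z1 t - z2 t)\<^sup>2)"
  define D' where "D' = (\<lambda>t. 2 * ((z1 t - z2 t) * (b (z1 t) - b (z2 t))))"
  have D: "(D has_real_derivative D' t) (at t)" for t
    unfolding D_def D'_def by (auto intro!: derivative_eq_intros z1 z2)
  have D'_le: "\<bar>D' t\<bar> \<le> 2 * K * D t" for t
  proof -
    have "\<bar>b (z1 t) - b (z2 t)\<bar> \<le> K * \<bar>z1 t - z2 t\<bar>"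
      using lipschitz_onD[OF lipschitz, of "z1 t" "z2 t"] by (simp add: dist_real_def)
    then have "\<bar>z1 t - z2 t\<bar> * \<bar>b (z1 t) - b (z2 t)\<bar> \<le> \<bar>z1 t - z2 t\<bar> * (K * \<bar>z1 t - z2 t\<bar>)"
      by (rule mult_left_mono) simp
    also have "\<dots> = K * D t"
      by (simp add: D_def power2_eq_square)
    finally show ?thesis
      by (simp add: D'_def abs_mult)
  qed
  have "D t \<le> exp (2 * K * \<bar>t\<bar>) * D 0"
  proof (cases "0 \<le> t")
    case True
    define E where "E = (\<lambda>s. exp (- (2 * K * s)) * D s)"
    have "E t \<le> E 0"
    proof (rule DERIV_nonpos_imp_nonincreasing[OF True])
      fix s
      have "(E has_real_derivative exp (- (2 * K * s)) * (D' s - 2 * K * D s)) (at s)"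
        unfolding E_def by (auto intro!: derivative_eq_intros D simp: algebra_simps)
      moreover have "exp (- (2 * K * s)) * (D' s - 2 * K * D s) \<le> 0"
        using D'_le[of s] by (intro mult_nonneg_nonpos) auto
      ultimately show "\<exists>m. (E has_real_derivative m) (at s) \<and> m \<le> 0" by blast
    qed
    then show ?thesis
      using True by (simp add: E_def exp_minus field_simps)
  next
    case False
    define E where "E = (\<lambda>s. exp (2 * K * s) * D s)"
    have "E t \<le> E 0"
    proof (rule DERIV_nonneg_imp_nondecreasing[where f = E])
      fix s
      have "(E has_real_derivative exp (2 * K * s) * (D' s + 2 * K * D s)) (at s)"
        unfolding E_def by (auto intro!: derivative_eq_intros D simp: algebra_simps)
      moreover have "0 \<le> exp (2 * K * s) * (D' s + 2 * K * D s)"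
        using D'_le[of s] by (intro mult_nonneg_nonneg) auto
      ultimately show "\<exists>m. (E has_real_derivative m) (at s) \<and> 0 \<le> m" by blast
    qed (use False in simp)
    then show ?thesis
      using False by (simp add: E_def exp_minus field_simps)
  qed
  then have "\<bar>z1 t - z2 t\<bar>\<^sup>2 \<le> (exp (K * \<bar>t\<bar>) * \<bar>z1 0 - z2 0\<bar>)\<^sup>2"
    by (simp add: D_def power_mult_distrib exp_double[symmetric] mult.assoc)
  then show ?thesis
    by (rule power2_le_imp_le) simp
qed

section \<open>Group law, periodicity and monotonicity of the flow\<close>

lemma flow_lipschitz: "\<bar>y x t - y x' t\<bar> \<le> exp (K * \<bar>t\<bar>) * \<bar>x - x'\<bar>"
  using solutions_distance[OF flow_deriv flow_deriv, of x t x'] by (simp add: flow_0)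

lemma flow_unique:
  assumes "\<And>t. (z has_real_derivative b (z t)) (at t)"
  shows "z t = y (z 0) t"
  using solutions_distance[OF assms flow_deriv, of t "z 0"] by (simp add: flow_0)

lemma flow_add: "y (y x s) t = y x (s + t)"
proof -
  have "((\<lambda>t. y x (s + t)) has_real_derivative b (y x (s + t))) (at t)" for t
    using DERIV_shift[of "y x" "b (y x (s + t))" t s] flow_deriv[of x "t + s"] by (simp add: add.commute)
  from flow_unique[OF this, of t] show ?thesis by simp
qed

lemma flow_inverse: "y (y x s) (- s) = x" "y (y x (- s)) s = x"
  by (simp_all add: flow_add flow_0)

lemma flow_plus_1: "y (x + 1) t = y x t + 1"
proof -
  have "((\<lambda>t. y x t + 1) has_real_derivative b (y x t + 1)) (at t)" for t
    by (auto intro!: derivative_eq_intros flow_deriv simp: b.plus_1)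
  from flow_unique[OF this, of t] show ?thesis by (simp add: flow_0)
qed

text \<open>Trajectories cannot cross. If the order were lost at time t, the continuous difference
  would vanish at some time s, and following the flow back from s would identify the two starting
  points.\<close>

lemma flow_less:
  assumes "x < x'"
  shows "y x t < y x' t"
proof (rule ccontr)
  define d where "d = (\<lambda>s. y x' s - y x s)"
  assume "\<not> ?thesis"
  then have "d t \<le> 0" "0 \<le> d 0"
    using assms by (auto simp: d_def flow_0)
  have "(d has_real_derivative b (y x' s) - b (y x s)) (at s)" for s
    unfolding d_def by (intro derivative_intros flow_deriv)
  then have "continuous_on UNIV d"
    by (meson DERIV_isCont continuous_at_imp_continuous_on)
  then have "connected (range d)"
    by (intro connected_continuous_image) auto
  then have "0 \<in> range d"
    using \<open>d t \<le> 0\<close> \<open>0 \<le> d 0\<close> connectedD_interval[of "range d" "d t" "d 0" 0] by blast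
  then obtain s where "y x' s = y x s" by (auto simp: d_def)
  then have "x' = x" by (metis flow_inverse(1))
  then show False using assms by simp
qed

lemma flow_le: "x \<le> x' \<Longrightarrow> y x t \<le> y x' t"
  using flow_less[of x x' t] by (cases "x = x'") auto

text \<open>The second bound is the Lipschitz estimate of the inverse flow, that is, of the flow
  over time -t.\<close>

lemma flow_increment:
  assumes "x \<le> x'"
  shows "y x' t - y x t \<le> exp (K * \<bar>t\<bar>) * (x' - x)" "x' - x \<le> exp (K * \<bar>t\<bar>) * (y x' t - y x t)"
  using flow_lipschitz[of x' t x] flow_lipschitz[of "y x' t" "- t" "y x t"] flow_le[OF assms, of t] assms
  by (simp_all add: flow_inverse)

text \<open>The map \<open>\<Phi>\<close> carries \<open>Omega\<close> onto a full period starting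
  at \<open>\<Phi> 0\<close>. The change of measure costs exp (K |t|), the Lipschitz constant of the
  inverse map, periodicity moves the window back to \<open>Omega\<close>, and the square root in the
  norm halves the exponent.\<close>

lemma flow_L2per:
  assumes u: "u \<in> L2per"
  shows "(\<lambda>x. u (y x (- t))) \<in> L2per"
    and "L2norm (\<lambda>x. u (y x (- t))) \<le> exp (1 / 2 * K * \<bar>t\<bar>) * L2norm u"
proof -
  define \<Phi> where "\<Phi> = (\<lambda>x. y x (- t))"
  have per: "periodic_fun_simple' u" and um: "u \<in> borel_measurable (lebesgue_on Omega)"
    and ui: "integrable (lebesgue_on Omega) (\<lambda>x. (u x)\<^sup>2)"
    using u by (auto simp: L2per_def)
  interpret u: periodic_fun_simple' u by (rule per)
  have um': "u \<in> borel_measurable lebesgue"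
    by (rule borel_measurable_periodic[OF per um])
  have lip: "(exp (K * \<bar>t\<bar>))-lipschitz_on UNIV (\<lambda>x. y x t)"
    using flow_lipschitz by (auto intro!: lipschitz_onI simp: dist_real_def)
  have mono: "mono \<Phi>" "mono (\<lambda>x. y x t)"
    by (auto simp: \<Phi>_def mono_def flow_le)
  have inv: "\<Phi> (y x t) = x" "y (\<Phi> x) t = x" for x
    by (simp_all add: \<Phi>_def flow_inverse)
  have \<Phi>1: "\<Phi> (x + 1) = \<Phi> x + 1" for x
    by (simp add: \<Phi>_def flow_plus_1)
  have \<Phi>m: "\<Phi> \<in> lebesgue \<rightarrow>\<^sub>M lebesgue"
    by (rule measurable_lebesgue_lipschitz_inverse[OF inv mono lip])
  have Om: "Omega \<in> sets lebesgue" by (simp add: Omega_def)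
  have u\<Phi>m: "(\<lambda>x. u (\<Phi> x)) \<in> borel_measurable (lebesgue_on Omega)"
    by (intro measurable_restrict_space1 measurable_compose[OF \<Phi>m um'])
  define W where "W = (\<lambda>x. ennreal ((u x)\<^sup>2))"
  have W: "W \<in> borel_measurable lebesgue"
    unfolding W_def using um' by measurable
  note W[measurable]
  have [measurable]: "{\<Phi> 0<..<\<Phi> 0 + 1} \<in> sets lebesgue"
    by simp
  have "(\<integral>\<^sup>+x. ennreal ((u (\<Phi> x))\<^sup>2) \<partial>lebesgue_on Omega) = (\<integral>\<^sup>+x. W (\<Phi> x) * indicator Omega x \<partial>lebesgue)"
    using Om by (simp add: nn_integral_restrict_space W_def)
  also have "\<dots> = (\<integral>\<^sup>+x. W (\<Phi> x) * indicator {\<Phi> 0<..<\<Phi> 0 + 1} (\<Phi> x) \<partial>lebesgue)"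
  proof (intro nn_integral_cong)
    fix x
    have "\<Phi> 0 < \<Phi> x \<longleftrightarrow> 0 < x" "\<Phi> x < \<Phi> 1 \<longleftrightarrow> x < 1"
      unfolding \<Phi>_def using flow_less flow_le by (meson not_le)+
    then show "W (\<Phi> x) * indicator Omega x = W (\<Phi> x) * indicator {\<Phi> 0<..<\<Phi> 0 + 1} (\<Phi> x)"
      using \<Phi>1[of 0] by (simp add: indicator_def Omega_def)
  qed
  also have "\<dots> \<le> ennreal (exp (K * \<bar>t\<bar>)) * (\<integral>\<^sup>+x. W x * indicator {\<Phi> 0<..<\<Phi> 0 + 1} x \<partial>lebesgue)"
    by (rule nn_integral_compose_lipschitz_inverse[OF inv mono lip,
        where W = "\<lambda>x. W x * indicator {\<Phi> 0<..<\<Phi> 0 + 1} x"]) measurable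
  also have "\<dots> \<le> ennreal (exp (K * \<bar>t\<bar>)) * (\<integral>\<^sup>+x. W x * indicator Omega x \<partial>lebesgue)"
    by (intro mult_left_mono nn_integral_period_le[OF _ W])
      (auto simp: periodic_fun_simple'_iff W_def u.plus_1)
  also have "(\<integral>\<^sup>+x. W x * indicator Omega x \<partial>lebesgue) = (\<integral>\<^sup>+x. ennreal ((u x)\<^sup>2) \<partial>lebesgue_on Omega)"
    using Om by (simp add: nn_integral_restrict_space W_def)
  also have "\<dots> = ennreal (LINT x|lebesgue_on Omega. (u x)\<^sup>2)"
    by (intro nn_integral_eq_integral ui) auto
  finally have nn: "(\<integral>\<^sup>+x. ennreal ((u (\<Phi> x))\<^sup>2) \<partial>lebesgue_on Omega) \<le>
      ennreal (exp (K * \<bar>t\<bar>) * (LINT x|lebesgue_on Omega. (u x)\<^sup>2))"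
    by (simp add: ennreal_mult)
  have int: "integrable (lebesgue_on Omega) (\<lambda>x. (u (\<Phi> x))\<^sup>2)"
  proof (rule integrableI_bounded)
    show "(\<lambda>x. (u (\<Phi> x))\<^sup>2) \<in> borel_measurable (lebesgue_on Omega)"
      using u\<Phi>m by measurable
    show "(\<integral>\<^sup>+x. ennreal (norm ((u (\<Phi> x))\<^sup>2)) \<partial>lebesgue_on Omega) < \<infinity>"
      using nn by (auto intro: le_less_trans)
  qed
  have "ennreal (LINT x|lebesgue_on Omega. (u (\<Phi> x))\<^sup>2) \<le>
      ennreal (exp (K * \<bar>t\<bar>) * (LINT x|lebesgue_on Omega. (u x)\<^sup>2))"
    using nn by (subst nn_integral_eq_integral[OF int, symmetric]) auto
  then have le: "(LINT x|lebesgue_on Omega. (u (\<Phi> x))\<^sup>2) \<le>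
      exp (K * \<bar>t\<bar>) * (LINT x|lebesgue_on Omega. (u x)\<^sup>2)"
    by (subst (asm) ennreal_le_iff) auto
  show "(\<lambda>x. u (y x (- t))) \<in> L2per"
    using int u\<Phi>m by (simp add: L2per_def periodic_fun_simple'_iff \<Phi>_def flow_plus_1 u.plus_1)
  have "L2norm (\<lambda>x. u (\<Phi> x)) \<le> sqrt (exp (K * \<bar>t\<bar>)) * L2norm u"
    using le by (simp add: L2norm_def real_sqrt_mult[symmetric])
  moreover have "sqrt (exp (K * \<bar>t\<bar>)) = exp (1 / 2 * K * \<bar>t\<bar>)"
    by (rule real_sqrt_unique) (simp_all add: exp_double[symmetric])
  ultimately show "L2norm (\<lambda>x. u (y x (- t))) \<le> exp (1 / 2 * K * \<bar>t\<bar>) * L2norm u"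
    by (simp add: \<Phi>_def)
qed

end

section \<open>Gauss--Legendre quadrature\<close>

text \<open>The rule carried to an arbitrary interval. It is applied to whole cells, to the
  subintervals between breakpoints, and to the images of these under the flow.\<close>

definition gauss_node :: "(nat \<Rightarrow> real) \<Rightarrow> real \<Rightarrow> real \<Rightarrow> nat \<Rightarrow> real" where
  "gauss_node \<xi> a b \<alpha> = (a + b) / 2 + \<xi> \<alpha> * ((b - a) / 2)"

lemma poly_lipschitz_on_Icc:
  fixes p :: "real poly"
  obtains l where "l-lipschitz_on {a..b} (poly p)"
proof -
  have "compact (poly (pderiv p) ` {a..b})"
    by (intro compact_continuous_image continuous_intros) simp
  then have "bounded (poly (pderiv p) ` {a..b})"
    by (rule compact_imp_bounded)
  then obtain B where B: "0 < B" "\<And>x. x \<in> {a..b} \<Longrightarrow> \<bar>poly (pderiv p) x\<bar> \<le> B"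
    by (auto simp: bounded_pos)
  have "B-lipschitz_on {a..b} (poly p)"
  proof (rule lipschitz_onI)
    fix x z assume "x \<in> {a..b}" "z \<in> {a..b}"
    then have "norm (poly p x - poly p z) \<le> B * norm (x - z)"
      using B by (intro field_differentiable_bound[where S = "{a..b}" and f' = "poly (pderiv p)"])
        (auto intro: poly_DERIV has_field_derivative_at_within)
    then show "dist (poly p x) (poly p z) \<le> B * dist x z"
      by (simp add: dist_norm)
  qed (use B in simp)
  then show thesis by (rule that)
qed

lemma affine_inverse:
  fixes a b s x :: real
  assumes "a < b"
  shows "- (a + b) / (b - a) + ((a + b) / 2 + s * ((b - a) / 2)) * (2 / (b - a)) = s"
    and "(a + b) / 2 + (- (a + b) / (b - a) + x * (2 / (b - a))) * ((b - a) / 2) = x"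
proof -
  define h where "h = b - a"
  have h: "b = a + h" "h \<noteq> 0" using assms by (auto simp: h_def)
  show "- (a + b) / (b - a) + ((a + b) / 2 + s * ((b - a) / 2)) * (2 / (b - a)) = s"
    "(a + b) / 2 + (- (a + b) / (b - a) + x * (2 / (b - a))) * ((b - a) / 2) = x"
    using h(2) unfolding h(1) by (simp_all add: field_simps)
qed

locale gauss_rule =
  fixes k :: nat and \<xi> w :: "nat \<Rightarrow> real"
  assumes gauss: "gauss_legendre k \<xi> w"
begin

lemma node_inj: "inj_on \<xi> {..k}"
  and node_bounds: "\<alpha> \<le> k \<Longrightarrow> -1 < \<xi> \<alpha>" "\<alpha> \<le> k \<Longrightarrow> \<xi> \<alpha> < 1"
  and weight_pos: "\<alpha> \<le> k \<Longrightarrow> 0 < w \<alpha>"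
  and exact: "degree p \<le> 2 * k + 1 \<Longrightarrow> (\<Sum>\<alpha>\<le>k. w \<alpha> * poly p (\<xi> \<alpha>)) = integral {-1..1} (poly p)"
  using gauss by (auto simp: gauss_legendre_def)

lemma gauss_node_in:
  assumes "\<alpha> \<le> k" "a < b"
  shows "gauss_node \<xi> a b \<alpha> \<in> {a<..<b}"
proof -
  have "0 < (1 + \<xi> \<alpha>) * ((b - a) / 2)" "0 < (1 - \<xi> \<alpha>) * ((b - a) / 2)"
    using node_bounds[OF assms(1)] assms(2) by auto
  then show ?thesis
    by (simp add: gauss_node_def field_simps)
qed

section \<open>Lagrange interpolation at the Gauss nodes\<close>

definition lagrange :: "nat \<Rightarrow> real poly" where
  "lagrange \<beta> = (\<Prod>\<gamma>\<in>{..k} - {\<beta>}. [: - \<xi> \<gamma> / (\<xi> \<beta> - \<xi> \<gamma>), 1 / (\<xi> \<beta> - \<xi> \<gamma>) :])"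

lemma degree_lagrange: "\<beta> \<le> k \<Longrightarrow> degree (lagrange \<beta>) \<le> k"
proof -
  assume \<beta>: "\<beta> \<le> k"
  have "degree (lagrange \<beta>) \<le> (\<Sum>\<gamma>\<in>{..k} - {\<beta>}. 1)"
    unfolding lagrange_def
  proof (rule order_trans[OF degree_prod_sum_le sum_mono])
    show "(degree \<circ> (\<lambda>\<gamma>. [: - \<xi> \<gamma> / (\<xi> \<beta> - \<xi> \<gamma>), 1 / (\<xi> \<beta> - \<xi> \<gamma>) :])) \<gamma> \<le> 1" for \<gamma>
      using degree_pCons_le[of "- \<xi> \<gamma> / (\<xi> \<beta> - \<xi> \<gamma>)" "[: 1 / (\<xi> \<beta> - \<xi> \<gamma>) :]"] by simp
  qed simp
  also have "\<dots> = k" using \<beta> by simp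
  finally show ?thesis .
qed

lemma poly_lagrange:
  assumes "\<alpha> \<le> k" "\<beta> \<le> k"
  shows "poly (lagrange \<beta>) (\<xi> \<alpha>) = (if \<alpha> = \<beta> then 1 else 0)"
proof -
  have eq: "poly (lagrange \<beta>) (\<xi> \<alpha>) = (\<Prod>\<gamma>\<in>{..k} - {\<beta>}. (\<xi> \<alpha> - \<xi> \<gamma>) / (\<xi> \<beta> - \<xi> \<gamma>))"
    unfolding lagrange_def poly_prod by (intro prod.cong) (auto simp: diff_divide_distrib)
  have ne: "\<xi> \<beta> - \<xi> \<gamma> \<noteq> 0" if "\<gamma> \<in> {..k} - {\<beta>}" for \<gamma>
    using inj_onD[OF node_inj, of \<beta> \<gamma>] that assms by auto
  show ?thesis
  proof (cases "\<alpha> = \<beta>")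
    case True
    then show ?thesis unfolding eq using ne by simp
  next
    case False
    then show ?thesis unfolding eq using assms by (auto intro!: prod_zero)
  qed
qed

lemma interpolation:
  assumes "degree p \<le> k"
  shows "poly p x = (\<Sum>\<beta>\<le>k. poly p (\<xi> \<beta>) * poly (lagrange \<beta>) x)"
proof -
  define q where "q = (\<Sum>\<beta>\<le>k. smult (poly p (\<xi> \<beta>)) (lagrange \<beta>))"
  have "p = q"
  proof (rule poly_eqI_degree)
    fix z assume "z \<in> \<xi> ` {..k}"
    then obtain \<alpha> where \<alpha>: "\<alpha> \<le> k" "z = \<xi> \<alpha>" by auto
    have "poly q z = (\<Sum>\<beta>\<le>k. if \<alpha> = \<beta> then poly p (\<xi> \<beta>) else 0)"
      unfolding q_def poly_sum \<alpha>(2) using \<alpha>(1) by (intro sum.cong) (auto simp: poly_lagrange)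
    then show "poly p z = poly q z" using \<alpha> by simp
  next
    have "degree q \<le> k"
      unfolding q_def by (intro degree_sum_le) (auto intro: order_trans[OF degree_smult_le] degree_lagrange)
    then show "degree q < card (\<xi> ` {..k})" "degree p < card (\<xi> ` {..k})"
      using assms by (auto simp: card_image[OF node_inj])
  qed
  then have "poly p x = poly q x" by simp
  also have "\<dots> = (\<Sum>\<beta>\<le>k. poly p (\<xi> \<beta>) * poly (lagrange \<beta>) x)"
    by (simp add: q_def poly_sum)
  finally show ?thesis .
qed

definition cell_lagrange :: "real \<Rightarrow> real \<Rightarrow> nat \<Rightarrow> real poly" where
  "cell_lagrange a b \<beta> = pcompose (lagrange \<beta>) [: - (a + b) / (b - a), 2 / (b - a) :]"

lemma degree_cell_lagrange: "\<beta> \<le> k \<Longrightarrow> degree (cell_lagrange a b \<beta>) \<le> k"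
  unfolding cell_lagrange_def degree_pcompose
  using degree_lagrange[of \<beta>] by (auto intro: order_trans[of _ "degree (lagrange \<beta>)"])

lemma poly_cell_lagrange:
  assumes "\<alpha> \<le> k" "\<beta> \<le> k" "a < b"
  shows "poly (cell_lagrange a b \<beta>) (gauss_node \<xi> a b \<alpha>) = (if \<alpha> = \<beta> then 1 else 0)"
proof -
  have "- (a + b) / (b - a) + gauss_node \<xi> a b \<alpha> * (2 / (b - a)) = \<xi> \<alpha>"
    unfolding gauss_node_def by (rule affine_inverse(1)[OF assms(3)])
  then show ?thesis
    using assms by (simp add: cell_lagrange_def poly_pcompose poly_lagrange)
qed

lemma cell_interpolation:
  assumes p: "degree p \<le> k" and ab: "a < b"
  shows "poly p x = (\<Sum>\<beta>\<le>k. poly p (gauss_node \<xi> a b \<beta>) * poly (cell_lagrange a b \<beta>) x)"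
proof -
  define q where "q = pcompose p [: (a + b) / 2, (b - a) / 2 :]"
  define z where "z = - (a + b) / (b - a) + x * (2 / (b - a))"
  have "degree q \<le> k"
    unfolding q_def degree_pcompose using p by (auto intro: order_trans[of _ "degree p"])
  moreover have "(a + b) / 2 + z * ((b - a) / 2) = x"
    unfolding z_def by (rule affine_inverse(2)[OF ab])
  then have "poly p x = poly q z"
    by (simp add: q_def poly_pcompose)
  moreover have "poly q (\<xi> \<beta>) = poly p (gauss_node \<xi> a b \<beta>)" for \<beta>
    by (simp add: q_def poly_pcompose gauss_node_def)
  moreover have "poly (cell_lagrange a b \<beta>) x = poly (lagrange \<beta>) z" for \<beta>
    by (simp add: cell_lagrange_def poly_pcompose z_def)
  ultimately show ?thesis
    using interpolation[of q z] by simp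
qed

text \<open>The product of the two polynomials has degree at most 2 k, within the range of
  exactness. Agreement is asked only in the open interval, where all Gauss nodes lie, because
  elements of \<open>V\<close> are unconstrained at mesh nodes.\<close>

lemma gauss_has_integral:
  assumes ab: "a < b"
    and p: "degree p \<le> k" "\<And>x. x \<in> {a<..<b} \<Longrightarrow> f x = poly p x"
    and q: "degree q \<le> k" "\<And>x. x \<in> {a<..<b} \<Longrightarrow> g x = poly q x"
  shows "((\<lambda>x. f x * g x) has_integral
    (\<Sum>\<alpha>\<le>k. w \<alpha> / 2 * (b - a) * f (gauss_node \<xi> a b \<alpha>) * g (gauss_node \<xi> a b \<alpha>))) {a..b}"
proof -
  define r where "r = pcompose (p * q) [: (a + b) / 2, (b - a) / 2 :]"
  define S where "S = (\<Sum>\<alpha>\<le>k. w \<alpha> * poly r (\<xi> \<alpha>))"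
  define m where "m = 2 / (b - a)"
  define c where "c = - (a + b) / (b - a)"
  have "degree r \<le> 2 * k + 1"
  proof -
    have "degree r \<le> degree (p * q) * 1"
      unfolding r_def degree_pcompose by (intro mult_left_mono) auto
    also have "\<dots> \<le> degree p + degree q"
      using degree_mult_le[of p q] by simp
    finally show ?thesis using p q by linarith
  qed
  then have "S = integral {-1..1} (poly r)"
    unfolding S_def by (rule exact)
  moreover have "poly r integrable_on {-1..1}"
    by (intro integrable_continuous_interval continuous_intros)
  ultimately have "(poly r has_integral S) (cbox (-1) 1)"
    by (simp add: has_integral_integral)
  moreover have "0 < m" using ab by (simp add: m_def)
  ultimately have "((\<lambda>x. poly r (m *\<^sub>R x + c)) has_integral (S /\<^sub>R m ^ DIM(real)))
      (cbox ((-1 - c) /\<^sub>R m) ((1 - c) /\<^sub>R m))"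
    by (rule has_integral_affinity')
  moreover have "(-1 - c) /\<^sub>R m = a" "(1 - c) /\<^sub>R m = b"
    using ab by (auto simp: m_def c_def field_simps)
  moreover have "poly r (m *\<^sub>R x + c) = poly p x * poly q x" for x
  proof -
    have "(a + b) / 2 + (m * x + c) * ((b - a) / 2) = x"
      using affine_inverse(2)[OF ab, of x] by (simp add: m_def c_def ac_simps)
    then show ?thesis by (simp add: r_def poly_pcompose)
  qed
  ultimately have "((\<lambda>x. poly p x * poly q x) has_integral (S /\<^sub>R m)) (cbox a b)"
    by simp
  then have "((\<lambda>x. f x * g x) has_integral (S /\<^sub>R m)) (cbox a b)"
    by (rule has_integral_spike_interior) (simp add: p q)
  moreover have "S /\<^sub>R m =
    (\<Sum>\<alpha>\<le>k. w \<alpha> / 2 * (b - a) * f (gauss_node \<xi> a b \<alpha>) * g (gauss_node \<xi> a b \<alpha>))"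
  proof -
    have "poly r (\<xi> \<alpha>) = f (gauss_node \<xi> a b \<alpha>) * g (gauss_node \<xi> a b \<alpha>)" if "\<alpha> \<le> k" for \<alpha>
      using gauss_node_in[OF that ab] by (simp add: r_def poly_pcompose gauss_node_def p q)
    then show ?thesis
      by (simp add: S_def m_def divide_simps sum_distrib_left sum_distrib_right ac_simps)
  qed
  ultimately show ?thesis by simp
qed

text \<open>Since the values of \<open>q\<close> at the Gauss nodes are controlled by the quadrature norm of \<open>q\<close>,
  Lagrange interpolation makes moving the nodes by \<open>\<delta>\<close> a relative perturbation of order \<open>\<delta>\<close>.\<close>

lemma gauss_sum_perturbation:
  obtains \<Lambda> where "0 \<le> \<Lambda>" "\<And>q z \<delta>. degree q \<le> k \<Longrightarrow>
    (\<And>\<alpha>. \<alpha> \<le> k \<Longrightarrow> \<bar>z \<alpha>\<bar> \<le> 1 \<and> \<bar>z \<alpha> - \<xi> \<alpha>\<bar> \<le> \<delta>) \<Longrightarrow>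
    (\<Sum>\<alpha>\<le>k. w \<alpha> * (poly q (z \<alpha>))\<^sup>2) \<le> (1 + \<Lambda> * \<delta>) * (\<Sum>\<alpha>\<le>k. w \<alpha> * (poly q (\<xi> \<alpha>))\<^sup>2)"
proof -
  have "\<forall>\<beta>. \<exists>l. l-lipschitz_on {-1..1} (poly (lagrange \<beta>))"
    using poly_lipschitz_on_Icc by metis
  then obtain l where l: "\<And>\<beta>. (l \<beta>)-lipschitz_on {-1..1} (poly (lagrange \<beta>))"
    by metis
  have "\<exists>B>0. \<forall>x\<in>{-1..1}. \<bar>poly (lagrange \<beta>) x\<bar> \<le> B" for \<beta>
  proof -
    have "compact (poly (lagrange \<beta>) ` {-1..1})"
      by (intro compact_continuous_image continuous_intros) simp
    then show ?thesis
      using compact_imp_bounded[of "poly (lagrange \<beta>) ` {-1..1}"]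
      by (auto simp: bounded_pos)
  qed
  then obtain B where B: "\<And>\<beta>. 0 < B \<beta>" "\<And>\<beta> x. x \<in> {-1..1} \<Longrightarrow> \<bar>poly (lagrange \<beta>) x\<bar> \<le> B \<beta>"
    by metis
  have l0: "0 \<le> l \<beta>" for \<beta>
    using l lipschitz_on_nonneg by blast
  \<comment> \<open>Each nodal value of q is at most sqrt (S / w \<beta>), where S is the Gauss sum
    of the square of q. With q (z)^2 - q (\<xi>)^2 factored into a difference and a sum,
    \<open>A1\<close> controls the difference through the Lipschitz constants of the Lagrange basis,
    and \<open>A2\<close> controls the sum through its suprema. The total weight in
    \<open>\<Lambda>\<close> comes from summing the resulting error over the nodes.\<close>
  define A1 where "A1 = (\<Sum>\<beta>\<le>k. l \<beta> / sqrt (w \<beta>))"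
  define A2 where "A2 = (\<Sum>\<beta>\<le>k. 2 * B \<beta> / sqrt (w \<beta>))"
  have A: "0 \<le> A1" "0 \<le> A2"
    unfolding A1_def A2_def using l0 B(1) weight_pos
    by (auto intro!: sum_nonneg divide_nonneg_nonneg simp: less_imp_le)
  define \<Lambda> where "\<Lambda> = (\<Sum>\<alpha>\<le>k. w \<alpha>) * (A1 * A2)"
  show thesis
  proof
    show "0 \<le> \<Lambda>"
      unfolding \<Lambda>_def using A weight_pos by (auto intro!: mult_nonneg_nonneg sum_nonneg simp: less_imp_le)
  next
    fix q :: "real poly" and z \<delta>
    assume q: "degree q \<le> k" and z: "\<And>\<alpha>. \<alpha> \<le> k \<Longrightarrow> \<bar>z \<alpha>\<bar> \<le> 1 \<and> \<bar>z \<alpha> - \<xi> \<alpha>\<bar> \<le> \<delta>"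
    define S where "S = (\<Sum>\<alpha>\<le>k. w \<alpha> * (poly q (\<xi> \<alpha>))\<^sup>2)"
    have S0: "0 \<le> S"
      unfolding S_def using weight_pos by (auto intro!: sum_nonneg simp: less_imp_le)
    have \<delta>0: "0 \<le> \<delta>" using z[of 0] by linarith
    have qb: "\<bar>poly q (\<xi> \<beta>)\<bar> \<le> sqrt S / sqrt (w \<beta>)" if \<beta>: "\<beta> \<le> k" for \<beta>
    proof -
      have "w \<beta> * (poly q (\<xi> \<beta>))\<^sup>2 \<le> S"
        unfolding S_def using weight_pos \<beta>
        by (intro member_le_sum[of \<beta> "{..k}" "\<lambda>\<alpha>. w \<alpha> * (poly q (\<xi> \<alpha>))\<^sup>2"]) (auto simp: less_imp_le)
      then have "(poly q (\<xi> \<beta>))\<^sup>2 \<le> S / w \<beta>"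
        using weight_pos[OF \<beta>] by (simp add: field_simps)
      then have "sqrt ((poly q (\<xi> \<beta>))\<^sup>2) \<le> sqrt (S / w \<beta>)"
        by (rule real_sqrt_le_mono)
      then show ?thesis by (simp add: real_sqrt_divide)
    qed
    have step: "(poly q (z \<alpha>))\<^sup>2 - (poly q (\<xi> \<alpha>))\<^sup>2 \<le> A1 * A2 * \<delta> * S" if \<alpha>: "\<alpha> \<le> k" for \<alpha>
    proof -
      have in1: "z \<alpha> \<in> {-1..1}" "\<xi> \<alpha> \<in> {-1..1}"
        using z[OF \<alpha>] node_bounds[OF \<alpha>] by auto
      have "\<bar>poly q (z \<alpha>) - poly q (\<xi> \<alpha>)\<bar> =
          \<bar>\<Sum>\<beta>\<le>k. poly q (\<xi> \<beta>) * (poly (lagrange \<beta>) (z \<alpha>) - poly (lagrange \<beta>) (\<xi> \<alpha>))\<bar>"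
        unfolding interpolation[OF q, of "z \<alpha>"] interpolation[OF q, of "\<xi> \<alpha>"]
        by (simp add: sum_subtractf[symmetric] right_diff_distrib)
      also have "\<dots> \<le> (\<Sum>\<beta>\<le>k. \<bar>poly q (\<xi> \<beta>) * (poly (lagrange \<beta>) (z \<alpha>) - poly (lagrange \<beta>) (\<xi> \<alpha>))\<bar>)"
        by (rule sum_abs)
      also have "\<dots> \<le> (\<Sum>\<beta>\<le>k. sqrt S / sqrt (w \<beta>) * (l \<beta> * \<delta>))"
      proof (intro sum_mono)
        fix \<beta> assume \<beta>: "\<beta> \<in> {..k}"
        have "\<bar>poly (lagrange \<beta>) (z \<alpha>) - poly (lagrange \<beta>) (\<xi> \<alpha>)\<bar> \<le> l \<beta> * \<bar>z \<alpha> - \<xi> \<alpha>\<bar>"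
          using lipschitz_onD[OF l in1] by (simp add: dist_real_def)
        also have "\<dots> \<le> l \<beta> * \<delta>"
          using z[OF \<alpha>] l0 by (intro mult_left_mono) auto
        finally show "\<bar>poly q (\<xi> \<beta>) * (poly (lagrange \<beta>) (z \<alpha>) - poly (lagrange \<beta>) (\<xi> \<alpha>))\<bar>
            \<le> sqrt S / sqrt (w \<beta>) * (l \<beta> * \<delta>)"
          unfolding abs_mult using qb[of \<beta>] \<beta> S0 weight_pos[of \<beta>]
          by (intro mult_mono) (auto simp: less_imp_le)
      qed
      also have "\<dots> = sqrt S * \<delta> * A1"
        unfolding A1_def sum_distrib_left by (intro sum.cong) auto
      finally have d: "\<bar>poly q (z \<alpha>) - poly q (\<xi> \<alpha>)\<bar> \<le> sqrt S * \<delta> * A1" .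
      have "\<bar>poly q (z \<alpha>) + poly q (\<xi> \<alpha>)\<bar> =
          \<bar>\<Sum>\<beta>\<le>k. poly q (\<xi> \<beta>) * (poly (lagrange \<beta>) (z \<alpha>) + poly (lagrange \<beta>) (\<xi> \<alpha>))\<bar>"
        unfolding interpolation[OF q, of "z \<alpha>"] interpolation[OF q, of "\<xi> \<alpha>"]
        by (simp add: sum.distrib[symmetric] distrib_left)
      also have "\<dots> \<le> (\<Sum>\<beta>\<le>k. \<bar>poly q (\<xi> \<beta>) * (poly (lagrange \<beta>) (z \<alpha>) + poly (lagrange \<beta>) (\<xi> \<alpha>))\<bar>)"
        by (rule sum_abs)
      also have "\<dots> \<le> (\<Sum>\<beta>\<le>k. sqrt S / sqrt (w \<beta>) * (2 * B \<beta>))"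
      proof (intro sum_mono)
        fix \<beta> assume \<beta>: "\<beta> \<in> {..k}"
        have "\<bar>poly (lagrange \<beta>) (z \<alpha>) + poly (lagrange \<beta>) (\<xi> \<alpha>)\<bar> \<le> 2 * B \<beta>"
          using B(2)[OF in1(1), of \<beta>] B(2)[OF in1(2), of \<beta>] by linarith
        then show "\<bar>poly q (\<xi> \<beta>) * (poly (lagrange \<beta>) (z \<alpha>) + poly (lagrange \<beta>) (\<xi> \<alpha>))\<bar>
            \<le> sqrt S / sqrt (w \<beta>) * (2 * B \<beta>)"
          unfolding abs_mult using qb[of \<beta>] \<beta> S0 weight_pos[of \<beta>]
          by (intro mult_mono) (auto simp: less_imp_le)
      qed
      also have "\<dots> = sqrt S * A2"
        unfolding A2_def sum_distrib_left by (intro sum.cong) auto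
      finally have s: "\<bar>poly q (z \<alpha>) + poly q (\<xi> \<alpha>)\<bar> \<le> sqrt S * A2" .
      have "(poly q (z \<alpha>))\<^sup>2 - (poly q (\<xi> \<alpha>))\<^sup>2 = (poly q (z \<alpha>) - poly q (\<xi> \<alpha>)) * (poly q (z \<alpha>) + poly q (\<xi> \<alpha>))"
        by (simp add: power2_eq_square algebra_simps)
      also have "\<dots> \<le> \<bar>poly q (z \<alpha>) - poly q (\<xi> \<alpha>)\<bar> * \<bar>poly q (z \<alpha>) + poly q (\<xi> \<alpha>)\<bar>"
        unfolding abs_mult[symmetric] by (rule abs_ge_self)
      also have "\<dots> \<le> (sqrt S * \<delta> * A1) * (sqrt S * A2)"
        using d s S0 \<delta>0 A by (intro mult_mono) auto
      also have "\<dots> = A1 * A2 * \<delta> * (sqrt S * sqrt S)"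
        by (simp only: ac_simps)
      also have "\<dots> = A1 * A2 * \<delta> * S"
        using S0 by simp
      finally show ?thesis .
    qed
    have "(\<Sum>\<alpha>\<le>k. w \<alpha> * (poly q (z \<alpha>))\<^sup>2) \<le> (\<Sum>\<alpha>\<le>k. w \<alpha> * ((poly q (\<xi> \<alpha>))\<^sup>2 + A1 * A2 * \<delta> * S))"
    proof (intro sum_mono mult_left_mono)
      fix \<alpha> assume "\<alpha> \<in> {..k}"
      then show "(poly q (z \<alpha>))\<^sup>2 \<le> (poly q (\<xi> \<alpha>))\<^sup>2 + A1 * A2 * \<delta> * S" "0 \<le> w \<alpha>"
        using step[of \<alpha>] weight_pos[of \<alpha>] by auto
    qed
    also have "\<dots> = S + (\<Sum>\<alpha>\<le>k. w \<alpha>) * (A1 * A2 * \<delta> * S)"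
      by (simp add: S_def distrib_left sum.distrib sum_distrib_right)
    also have "\<dots> = (1 + \<Lambda> * \<delta>) * S"
      by (simp add: \<Lambda>_def algebra_simps)
    finally show "(\<Sum>\<alpha>\<le>k. w \<alpha> * (poly q (z \<alpha>))\<^sup>2) \<le> (1 + \<Lambda> * \<delta>) * (\<Sum>\<alpha>\<le>k. w \<alpha> * (poly q (\<xi> \<alpha>))\<^sup>2)"
      by (simp add: S_def)
  qed
qed

end

section \<open>Piecewise polynomials\<close>

text \<open>The order of the endpoints is part of the conclusion because joining the next interval
  in the induction depends on it.\<close>

lemma has_integral_telescope:
  fixes c :: "nat \<Rightarrow> real" and f :: "real \<Rightarrow> 'a::banach"
  assumes "\<And>q. q < n \<Longrightarrow> c q \<le> c (Suc q)"
    and "\<And>q. q < n \<Longrightarrow> (f has_integral I q) {c q..c (Suc q)}"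
  shows "(f has_integral (\<Sum>q<n. I q)) {c 0..c n} \<and> c 0 \<le> c n"
  using assms
proof (induction n)
  case 0
  then show ?case by (simp add: has_integral_refl)
next
  case (Suc n)
  then have "(f has_integral (\<Sum>q<n. I q)) {c 0..c n}" "c 0 \<le> c n" "c n \<le> c (Suc n)"
    "(f has_integral I n) {c n..c (Suc n)}" by auto
  then show ?case
    using has_integral_combine[of "c 0" "c n" "c (Suc n)" f] by auto
qed

text \<open>The bridge from the Lebesgue integral in \<open>L2inner\<close> to the gauge integral in
  which the quadrature identities are stated. Square integrability makes the product integrable, so
  the two integrals agree.\<close>

lemma L2inner_eq:
  assumes f: "f \<in> L2per" and g: "g \<in> L2per"
    and I: "((\<lambda>x. f x * g x) has_integral I) {0..1}"
  shows "L2inner f g = I"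
proof -
  have "integrable (lebesgue_on Omega) (\<lambda>x. f x * g x)"
  proof (rule Bochner_Integration.integrable_bound)
    show "integrable (lebesgue_on Omega) (\<lambda>x. (f x)\<^sup>2 + (g x)\<^sup>2)"
      using f g by (simp add: L2per_def)
    show "(\<lambda>x. f x * g x) \<in> borel_measurable (lebesgue_on Omega)"
      using f g by (intro borel_measurable_times) (simp_all add: L2per_def)
    have "\<bar>s * t\<bar> \<le> s\<^sup>2 + t\<^sup>2" for s t :: real
      using sum_squares_bound[of s t] sum_squares_bound[of "- s" t]
        zero_le_power2[of s] zero_le_power2[of t] by (simp add: abs_le_iff)
    then show "AE x in lebesgue_on Omega. norm (f x * g x) \<le> norm ((f x)\<^sup>2 + (g x)\<^sup>2)"
      by simp
  qed
  then have "L2inner f g = integral Omega (\<lambda>x. f x * g x)"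
    unfolding L2inner_def by (rule lebesgue_integral_eq_integral) (simp add: Omega_def)
  then show ?thesis
    using I by (simp add: has_integral_Icc_iff_Ioo Omega_def integral_unique)
qed

lemma L2norm_power2: "(L2norm f)\<^sup>2 = L2inner f f"
  by (simp add: L2norm_def L2inner_def power2_eq_square)

lemma L2norm_nonneg: "0 \<le> L2norm f"
  by (simp add: L2norm_def)

text \<open>The flow maps [0, 1] to a window of length 1 that in general does not start at an
  integer. This brings integrals over such a window back to the norm on
  \<open>Omega\<close>.\<close>

lemma has_integral_period_le:
  assumes u: "u \<in> L2per" and I: "((\<lambda>x. u x * u x) has_integral I) {c..c + 1}"
  shows "I \<le> (L2norm u)\<^sup>2"
proof -
  define W where "W = (\<lambda>x. ennreal (u x * u x))"
  have per: "periodic_fun_simple' u" and ui: "integrable (lebesgue_on Omega) (\<lambda>x. u x * u x)"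
    and um: "u \<in> borel_measurable (lebesgue_on Omega)"
    using u by (auto simp: L2per_def power2_eq_square)
  have um': "u \<in> borel_measurable lebesgue"
    by (rule borel_measurable_periodic[OF per um])
  have I0: "0 \<le> I"
    using I by (rule has_integral_nonneg) simp
  have "ennreal I = (\<integral>\<^sup>+x. W x * indicator {c<..<c + 1} x \<partial>lborel)"
    unfolding W_def using I
    by (intro nn_integral_has_integral_lebesgue'[symmetric]) (auto simp: has_integral_Icc_iff_Ioo)
  also have "\<dots> = (\<integral>\<^sup>+x. W x * indicator {c<..<c + 1} x \<partial>lebesgue)"
    by (simp add: nn_integral_completion)
  also have "\<dots> \<le> (\<integral>\<^sup>+x. W x * indicator Omega x \<partial>lebesgue)"
  proof (rule nn_integral_period_le)
    show "periodic_fun_simple' W"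
      using per by (simp add: periodic_fun_simple'_iff W_def)
    show "W \<in> borel_measurable lebesgue"
      unfolding W_def using um' by measurable
  qed
  also have "\<dots> = (\<integral>\<^sup>+x. ennreal (u x * u x) \<partial>lebesgue_on Omega)"
    by (simp add: nn_integral_restrict_space Omega_def W_def)
  also have "\<dots> = ennreal (L2inner u u)"
    unfolding L2inner_def by (intro nn_integral_eq_integral ui) auto
  finally have "ennreal I \<le> ennreal ((L2norm u)\<^sup>2)"
    by (simp add: L2norm_power2)
  then show ?thesis
    by (simp add: ennreal_le_iff)
qed

text \<open>The representative singled out in \<open>Tscheme\<close>: \<open>frac\<close> makes it
  periodic, and the cells being open makes it vanish at the mesh nodes.\<close>

definition piecewise_poly :: "nat \<Rightarrow> (nat \<Rightarrow> real poly) \<Rightarrow> real \<Rightarrow> real" where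
  "piecewise_poly M P x = (\<Sum>i<M. indicator (cell M i) (frac x) * poly (P i) (frac x))"

section \<open>Cells, mesh nodes and membership in \<open>V\<close>\<close>

lemma cell_iff: "0 < M \<Longrightarrow> x \<in> cell M i \<longleftrightarrow> real i < x * real M \<and> x * real M < real i + 1"
  by (simp add: cell_def field_simps)

lemma cell_unique:
  assumes "0 < M" "x \<in> cell M i" "x \<in> cell M j"
  shows "i = j"
proof -
  have "real i < real j + 1" "real j < real i + 1"
    using assms by (auto simp: cell_iff)
  then show ?thesis by linarith
qed

lemma cell_subset_Omega:
  assumes "i < M" "x \<in> cell M i"
  shows "x \<in> Omega"
proof -
  have M: "0 < real M" "real i + 1 \<le> real M" using assms(1) by auto
  moreover have "real i < x * real M" "x * real M < real i + 1"
    using assms by (auto simp: cell_iff)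
  ultimately have "0 < x * real M" "x * real M < real M"
    by linarith+
  then show ?thesis
    using M(1) by (simp add: Omega_def zero_less_mult_iff)
qed

lemma piecewise_poly_cell:
  assumes "i < M" "x \<in> cell M i"
  shows "piecewise_poly M P x = poly (P i) x"
proof -
  have "frac x = x"
    using cell_subset_Omega[OF assms] by (simp add: Omega_def frac_eq)
  moreover have "x \<in> cell M j \<longleftrightarrow> j = i" for j
    using cell_unique[of M x j i] assms by (metis less_nat_zero_code neq0_conv)
  then have "indicator (cell M j) x = (if j = i then 1 else 0 :: real)" for j
    by (simp add: indicator_def)
  then have "(\<Sum>j<M. indicator (cell M j) x * poly (P j) x) = (\<Sum>j<M. if j = i then poly (P j) x else 0)"
    by (intro sum.cong) auto
  ultimately show ?thesis
    using assms by (simp add: piecewise_poly_def)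
qed

lemma piecewise_poly_node:
  assumes "0 < M"
  shows "piecewise_poly M P (real_of_int j / real M) = 0"
proof -
  have "frac (real_of_int j / real M) \<notin> cell M i" for i
  proof
    assume "frac (real_of_int j / real M) \<in> cell M i"
    moreover have "frac (real_of_int j / real M) * real M
        = real_of_int (j - \<lfloor>real_of_int j / real M\<rfloor> * int M)"
      using assms by (simp add: frac_def field_simps)
    ultimately obtain l :: int where "real i < real_of_int l" "real_of_int l < real i + 1"
      using assms by (metis cell_iff)
    then have "real_of_int (int i) < real_of_int l" "real_of_int l < real_of_int (int i + 1)"
      by simp_all
    then have "int i < l" "l < int i + 1"
      by (simp_all only: of_int_less_iff)
    then show False by linarith
  qed
  then show ?thesis by (simp add: piecewise_poly_def)
qed

lemma piecewise_poly_in_V: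
  assumes "\<And>i. i < M \<Longrightarrow> degree (P i) \<le> k"
  shows "piecewise_poly M P \<in> V k M"
proof -
  define h where "h = (\<lambda>x. \<Sum>i<M. indicator (cell M i) x * poly (P i) x)"
  have eq: "piecewise_poly M P x = h x" if "x \<in> Omega" for x
    using that by (simp add: piecewise_poly_def h_def Omega_def frac_eq)
  have cellm [measurable]: "cell M i \<in> sets borel" for i
    by (simp add: cell_def)
  have [measurable]: "poly p \<in> borel_measurable borel" for p :: "real poly"
    by (intro borel_measurable_continuous_onI continuous_intros)
  have hm: "h \<in> borel_measurable borel"
    unfolding h_def by measurable
  then have hm': "h \<in> borel_measurable (lebesgue_on Omega)"
    by (intro measurable_restrict_space1 measurable_completion) simp
  then have meas: "piecewise_poly M P \<in> borel_measurable (lebesgue_on Omega)"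
    by (subst measurable_cong[where g = h]) (auto simp: eq)
  have "\<exists>B. \<forall>x\<in>Omega. \<bar>h x\<bar> \<le> B"
  proof -
    have "\<exists>B. \<forall>x\<in>{0..1}. \<bar>poly (P i) x\<bar> \<le> B" for i
    proof -
      have "compact (poly (P i) ` {0..1})"
        by (intro compact_continuous_image continuous_intros) simp
      then have "bounded (poly (P i) ` {0..1})"
        by (rule compact_imp_bounded)
      then show ?thesis by (auto simp: bounded_iff)
    qed
    then obtain B where B: "\<And>i x. x \<in> {0..1} \<Longrightarrow> \<bar>poly (P i) x\<bar> \<le> B i"
      by metis
    have "\<bar>h x\<bar> \<le> (\<Sum>i<M. B i)" if "x \<in> Omega" for x
      unfolding h_def
    proof (rule order_trans[OF sum_abs sum_mono])
      fix i
      show "\<bar>indicator (cell M i) x * poly (P i) x\<bar> \<le> B i"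
        using B[of x i] that by (auto simp: indicator_def Omega_def)
    qed
    then show ?thesis by blast
  qed
  then obtain B where B: "\<And>x. x \<in> Omega \<Longrightarrow> \<bar>h x\<bar> \<le> B" by blast
  have "integrable (lebesgue_on Omega) (\<lambda>x. (piecewise_poly M P x)\<^sup>2)"
  proof (rule Bochner_Integration.integrable_bound)
    show "integrable (lebesgue_on Omega) (\<lambda>x. B\<^sup>2)"
      by (intro finite_measure.integrable_const finite_measure_lebesgue_on) (simp add: Omega_def)
    show "(\<lambda>x. (piecewise_poly M P x)\<^sup>2) \<in> borel_measurable (lebesgue_on Omega)"
      using meas by measurable
    have "(h x)\<^sup>2 \<le> B\<^sup>2" if "x \<in> Omega" for x
      using B[OF that] by (metis abs_le_square_iff abs_of_nonneg abs_ge_zero order_trans)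
    then show "AE x in lebesgue_on Omega. norm ((piecewise_poly M P x)\<^sup>2) \<le> norm (B\<^sup>2)"
      by (intro AE_I2) (auto simp: eq)
  qed
  moreover have "periodic_fun_simple' (piecewise_poly M P)"
    by (simp add: periodic_fun_simple'_iff piecewise_poly_def frac_1_eq)
  ultimately have "piecewise_poly M P \<in> L2per"
    using meas by (simp add: L2per_def)
  then show ?thesis
    unfolding V_def using assms piecewise_poly_cell by blast
qed

lemma V_L2per: "v \<in> V k M \<Longrightarrow> v \<in> L2per"
  by (simp add: V_def)

lemma V_cell_poly:
  assumes "v \<in> V k M" "i < M"
  obtains p where "degree p \<le> k" "\<And>x. x \<in> cell M i \<Longrightarrow> v x = poly p x"
  using assms by (auto simp: V_def)

text \<open>The flow may carry a subinterval out of (0, 1), so mesh intervals of any integer index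
  occur. Division of the index by \<open>M\<close> gives the cell and the number of periods, and the
  polynomial of that cell is translated accordingly.\<close>

lemma V_translated_cell_poly:
  assumes v: "v \<in> V k M" and M: "0 < M"
  obtains p where "degree p \<le> k"
    "\<And>x. x \<in> {real_of_int j / real M<..<(real_of_int j + 1) / real M} \<Longrightarrow> v x = poly p x"
proof -
  interpret v: periodic_fun_simple' v
    using v by (simp add: V_def L2per_def)
  define i where "i = nat (j mod int M)"
  define n where "n = j div int M"
  have i: "i < M"
    using M by (simp add: i_def nat_less_iff)
  have j: "real_of_int j = real i + real_of_int n * real M"
  proof -
    have "j = int i + n * int M"
      using M by (simp add: i_def n_def)
    then show ?thesis by (metis of_int_add of_int_mult of_int_of_nat_eq)
  qed
  obtain p where p: "degree p \<le> k" "\<And>x. x \<in> cell M i \<Longrightarrow> v x = poly p x"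
    using V_cell_poly[OF v i] by blast
  show thesis
  proof
    show "degree (pcompose p [: - real_of_int n, 1 :]) \<le> k"
      using p(1) by (simp add: degree_pcompose)
    fix x assume "x \<in> {real_of_int j / real M<..<(real_of_int j + 1) / real M}"
    then have "x - real_of_int n \<in> cell M i"
      using M by (simp add: cell_iff j field_simps)
    then have "v (x - real_of_int n) = poly p (x - real_of_int n)"
      by (rule p(2))
    then show "v x = poly (pcompose p [: - real_of_int n, 1 :]) x"
      by (simp add: v.minus_of_int poly_pcompose)
  qed
qed

section \<open>Representation of functionals on \<open>V\<close> by nodal values\<close>

context gauss_rule
begin

abbreviation cell_node :: "nat \<Rightarrow> nat \<Rightarrow> nat \<Rightarrow> real" where
  "cell_node M i \<equiv> gauss_node \<xi> (real i / real M) ((real i + 1) / real M)"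

lemma cell_node_in: "0 < M \<Longrightarrow> \<alpha> \<le> k \<Longrightarrow> cell_node M i \<alpha> \<in> cell M i"
  using gauss_node_in[of \<alpha> "real i / real M" "(real i + 1) / real M"]
  by (simp add: cell_def divide_strict_right_mono)

lemma L2inner_V:
  assumes f: "f \<in> V k M" and g: "g \<in> V k M" and M: "0 < M"
  shows "L2inner f g = (\<Sum>i<M. \<Sum>\<alpha>\<le>k. w \<alpha> / 2 * (1 / real M) * f (cell_node M i \<alpha>) * g (cell_node M i \<alpha>))"
proof (rule L2inner_eq)
  have "((\<lambda>x. f x * g x) has_integral
      (\<Sum>i<M. \<Sum>\<alpha>\<le>k. w \<alpha> / 2 * (1 / real M) * f (cell_node M i \<alpha>) * g (cell_node M i \<alpha>)))
      {real 0 / real M..real M / real M} \<and> real 0 / real M \<le> real M / real M"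
  proof (rule has_integral_telescope[where c = "\<lambda>i. real i / real M"])
    fix i assume i: "i < M"
    show "real i / real M \<le> real (Suc i) / real M"
      by (simp add: divide_right_mono)
    obtain p where p: "degree p \<le> k" "\<And>x. x \<in> cell M i \<Longrightarrow> f x = poly p x"
      using V_cell_poly[OF f i] by blast
    obtain q where q: "degree q \<le> k" "\<And>x. x \<in> cell M i \<Longrightarrow> g x = poly q x"
      using V_cell_poly[OF g i] by blast
    have "(real i + 1) / real M - real i / real M = 1 / real M"
      by (simp add: diff_divide_distrib[symmetric])
    then show "((\<lambda>x. f x * g x) has_integral
        (\<Sum>\<alpha>\<le>k. w \<alpha> / 2 * (1 / real M) * f (cell_node M i \<alpha>) * g (cell_node M i \<alpha>)))
        {real i / real M..real (Suc i) / real M}"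
      using gauss_has_integral[of "real i / real M" "(real i + 1) / real M" p f q g] M p q
      by (simp add: cell_def divide_strict_right_mono add.commute)
  qed
  then show "((\<lambda>x. f x * g x) has_integral
      (\<Sum>i<M. \<Sum>\<alpha>\<le>k. w \<alpha> / 2 * (1 / real M) * f (cell_node M i \<alpha>) * g (cell_node M i \<alpha>))) {0..1}"
    using M by simp
qed (use f g V_L2per in auto)

lemma V_expand_cell:
  assumes \<phi>: "\<phi> \<in> V k M" and i: "i < M" and x: "x \<in> cell M i"
  shows "\<phi> x = (\<Sum>\<beta>\<le>k. \<phi> (cell_node M i \<beta>) *
    poly (cell_lagrange (real i / real M) ((real i + 1) / real M) \<beta>) x)"
proof -
  obtain p where p: "degree p \<le> k" "\<And>x. x \<in> cell M i \<Longrightarrow> \<phi> x = poly p x"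
    using V_cell_poly[OF \<phi> i] by blast
  have "real i / real M < (real i + 1) / real M"
    using i by (simp add: divide_strict_right_mono)
  from cell_interpolation[OF p(1) this, of x] show ?thesis
    using p(2)[OF cell_node_in] i unfolding p(2)[OF x] by simp
qed

text \<open>The Gauss nodes of the cells diagonalise the inner product of \<open>V k M\<close>, so a functional that
  only samples the cells is represented by prescribing its values at these nodes.\<close>

lemma V_riesz:
  fixes c :: "nat \<Rightarrow> 'j \<Rightarrow> real" and x :: "nat \<Rightarrow> 'j \<Rightarrow> real"
  assumes M: "0 < M" and x: "\<And>i j. i < M \<Longrightarrow> j \<in> J i \<Longrightarrow> x i j \<in> cell M i"
  shows "\<exists>!v. v \<in> V k M \<and> (\<forall>j :: int. v (real_of_int j / real M) = 0) \<and>
    (\<forall>\<phi>\<in>V k M. L2inner v \<phi> = (\<Sum>i<M. \<Sum>j\<in>J i. c i j * \<phi> (x i j)))"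
proof (rule ex_ex1I)
  let ?lag = "\<lambda>i. cell_lagrange (real i / real M) ((real i + 1) / real M)"
  have lt: "real i / real M < (real i + 1) / real M" for i
    using M by (simp add: divide_strict_right_mono)
  \<comment> \<open>In the nodal basis the Gram matrix is diagonal with entries w \<beta> / (2 M).
    The last factor inverts the entry.\<close>
  define val where "val = (\<lambda>i \<beta>. (\<Sum>j\<in>J i. c i j * poly (?lag i \<beta>) (x i j)) * (2 * real M / w \<beta>))"
  define P where "P = (\<lambda>i. \<Sum>\<beta>\<le>k. smult (val i \<beta>) (?lag i \<beta>))"
  define v where "v = piecewise_poly M P"
  have "degree (P i) \<le> k" for i
    unfolding P_def by (intro degree_sum_le) (auto intro: order_trans[OF degree_smult_le] degree_cell_lagrange)
  then have vV: "v \<in> V k M"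
    unfolding v_def by (rule piecewise_poly_in_V)
  have v_node: "v (cell_node M i \<alpha>) = val i \<alpha>" if "i < M" "\<alpha> \<le> k" for i \<alpha>
  proof -
    have "v (cell_node M i \<alpha>) = (\<Sum>\<beta>\<le>k. val i \<beta> * poly (?lag i \<beta>) (cell_node M i \<alpha>))"
      using piecewise_poly_cell[OF that(1) cell_node_in[OF M that(2)], of P] by (simp add: v_def P_def poly_sum)
    also have "\<dots> = (\<Sum>\<beta>\<le>k. if \<alpha> = \<beta> then val i \<beta> else 0)"
      using that(2) by (intro sum.cong) (auto simp: poly_cell_lagrange[OF _ _ lt])
    finally show ?thesis using that by simp
  qed
  have "L2inner v \<phi> = (\<Sum>i<M. \<Sum>j\<in>J i. c i j * \<phi> (x i j))" if \<phi>: "\<phi> \<in> V k M" for \<phi>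
    unfolding L2inner_V[OF vV \<phi> M]
  proof (rule sum.cong[OF refl])
    fix i assume "i \<in> {..<M}"
    then have i: "i < M" by simp
    have "(\<Sum>\<alpha>\<le>k. w \<alpha> / 2 * (1 / real M) * v (cell_node M i \<alpha>) * \<phi> (cell_node M i \<alpha>)) =
        (\<Sum>\<alpha>\<le>k. \<Sum>j\<in>J i. c i j * (\<phi> (cell_node M i \<alpha>) * poly (?lag i \<alpha>) (x i j)))"
    proof (rule sum.cong[OF refl])
      fix \<alpha> assume "\<alpha> \<in> {..k}"
      then have \<alpha>: "\<alpha> \<le> k" by simp
      have "w \<alpha> / 2 * (1 / real M) * val i \<alpha> = (\<Sum>j\<in>J i. c i j * poly (?lag i \<alpha>) (x i j))"
        using weight_pos[OF \<alpha>] M by (simp add: val_def)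
      then show "w \<alpha> / 2 * (1 / real M) * v (cell_node M i \<alpha>) * \<phi> (cell_node M i \<alpha>) =
          (\<Sum>j\<in>J i. c i j * (\<phi> (cell_node M i \<alpha>) * poly (?lag i \<alpha>) (x i j)))"
        unfolding v_node[OF i \<alpha>] by (simp only: sum_distrib_right mult.assoc mult.commute[of "poly _ _"])
    qed
    also have "\<dots> = (\<Sum>j\<in>J i. \<Sum>\<alpha>\<le>k. c i j * (\<phi> (cell_node M i \<alpha>) * poly (?lag i \<alpha>) (x i j)))"
      by (rule sum.swap)
    also have "\<dots> = (\<Sum>j\<in>J i. c i j * \<phi> (x i j))"
      using V_expand_cell[OF \<phi> i x[OF i]] by (intro sum.cong) (auto simp: sum_distrib_left)
    finally show "(\<Sum>\<alpha>\<le>k. w \<alpha> / 2 * (1 / real M) * v (cell_node M i \<alpha>) * \<phi> (cell_node M i \<alpha>)) =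
        (\<Sum>j\<in>J i. c i j * \<phi> (x i j))" .
  qed
  then show "\<exists>v. v \<in> V k M \<and> (\<forall>j :: int. v (real_of_int j / real M) = 0) \<and>
      (\<forall>\<phi>\<in>V k M. L2inner v \<phi> = (\<Sum>i<M. \<Sum>j\<in>J i. c i j * \<phi> (x i j)))"
    using vV piecewise_poly_node[OF M] unfolding v_def by blast
next
  fix v1 v2
  assume v1: "v1 \<in> V k M \<and> (\<forall>j :: int. v1 (real_of_int j / real M) = 0) \<and>
      (\<forall>\<phi>\<in>V k M. L2inner v1 \<phi> = (\<Sum>i<M. \<Sum>j\<in>J i. c i j * \<phi> (x i j)))"
    and v2: "v2 \<in> V k M \<and> (\<forall>j :: int. v2 (real_of_int j / real M) = 0) \<and>
      (\<forall>\<phi>\<in>V k M. L2inner v2 \<phi> = (\<Sum>i<M. \<Sum>j\<in>J i. c i j * \<phi> (x i j)))"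
  have lt: "real i / real M < (real i + 1) / real M" for i
    using M by (simp add: divide_strict_right_mono)
  have node_eq: "v1 (cell_node M i \<beta>) = v2 (cell_node M i \<beta>)" if i: "i < M" and \<beta>: "\<beta> \<le> k" for i \<beta>
  proof -
    \<comment> \<open>Testing with a single nodal basis function isolates one nodal value, up to the
      positive factor w \<beta> / (2 M).\<close>
    define \<phi> where "\<phi> = piecewise_poly M
      (\<lambda>i'. if i' = i then cell_lagrange (real i / real M) ((real i + 1) / real M) \<beta> else 0)"
    have \<phi>V: "\<phi> \<in> V k M"
      unfolding \<phi>_def using degree_cell_lagrange[OF \<beta>] by (intro piecewise_poly_in_V) auto
    have \<phi>_node: "\<phi> (cell_node M i' \<alpha>) = (if i' = i \<and> \<alpha> = \<beta> then 1 else 0)" if "i' < M" "\<alpha> \<le> k" for i' \<alpha>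
      unfolding \<phi>_def piecewise_poly_cell[OF that(1) cell_node_in[OF M that(2)]]
      using poly_cell_lagrange[OF that(2) \<beta> lt[of i]] by (cases "i' = i") auto
    have eval: "L2inner v \<phi> = w \<beta> / 2 * (1 / real M) * v (cell_node M i \<beta>)" if v: "v \<in> V k M" for v
    proof -
      have "L2inner v \<phi> = (\<Sum>i'<M. \<Sum>\<alpha>\<le>k. if i' = i then if \<alpha> = \<beta>
          then w \<beta> / 2 * (1 / real M) * v (cell_node M i \<beta>) else 0 else 0)"
        unfolding L2inner_V[OF v \<phi>V M] by (intro sum.cong) (auto simp: \<phi>_node)
      also have "\<dots> = (\<Sum>i'<M. if i' = i then w \<beta> / 2 * (1 / real M) * v (cell_node M i \<beta>) else 0)"
        using \<beta> by (intro sum.cong) auto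
      finally show ?thesis using i by simp
    qed
    have "L2inner v1 \<phi> = L2inner v2 \<phi>"
      using v1 v2 \<phi>V by simp
    then show ?thesis
      using eval[of v1] eval[of v2] v1 v2 weight_pos[OF \<beta>] M by simp
  qed
  have eq_cell: "v1 z = v2 z" if "i < M" "z \<in> cell M i" for i z
  proof -
    have "v1 \<in> V k M" "v2 \<in> V k M" using v1 v2 by auto
    note this[THEN V_expand_cell, OF that]
    then show ?thesis
      by (simp only:) (intro sum.cong, simp_all add: node_eq[OF that(1)])
  qed
  show "v1 = v2"
  proof
    fix z :: real
    interpret v1: periodic_fun_simple' v1 using v1 by (simp add: V_def L2per_def)
    interpret v2: periodic_fun_simple' v2 using v2 by (simp add: V_def L2per_def)
    define s where "s = frac z"
    define m where "m = \<lfloor>s * real M\<rfloor>"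
    have s: "0 \<le> s" "s < 1" by (simp_all add: s_def frac_lt_1)
    have "v1 s = v2 s"
    \<comment> \<open>Every point of [0, 1) is a mesh node or lies in a cell. At the nodes the inner
      product says nothing, and equality comes from the prescribed value 0.\<close>
    proof (cases "s * real M = real_of_int m")
      case True
      then have "s = real_of_int m / real M" using M by (simp add: field_simps)
      then show ?thesis using v1 v2 by simp
    next
      case False
      have "0 \<le> m" using s by (simp add: m_def)
      have "s * real M < real M" using s M by simp
      then have "nat m < M"
        using \<open>0 \<le> m\<close> unfolding m_def by linarith
      moreover have "real_of_int m < s * real M" "s * real M < real_of_int m + 1"
        using False unfolding m_def by linarith+
      then have "s \<in> cell M (nat m)"
        using M \<open>0 \<le> m\<close> by (simp add: cell_iff)
      ultimately show ?thesis by (rule eq_cell)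
    qed
    then show "v1 z = v2 z"
      by (simp add: s_def frac_def v1.minus_of_int v2.minus_of_int)
  qed
qed

end

section \<open>The scheme\<close>

text \<open>Finiteness makes \<open>sorted_list_of_set\<close> enumerate the breakpoints, and with
  both endpoints of the cell attached the list is strictly increasing. A breakpoint strictly between
  consecutive entries would need an index strictly between theirs.\<close>

lemma sub_pt_strict_sorted:
  assumes M: "0 < M" and fin: "finite (breaks y dt M i)"
  shows sub_pt_0: "sub_pt y dt M i 0 = real i / real M"
    and sub_pt_last: "sub_pt y dt M i (Suc (card (breaks y dt M i))) = (real i + 1) / real M"
    and sub_pt_less: "q \<le> card (breaks y dt M i) \<Longrightarrow> sub_pt y dt M i q < sub_pt y dt M i (Suc q)"
    and sub_pt_between: "q \<le> card (breaks y dt M i) \<Longrightarrow>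
      x \<in> {sub_pt y dt M i q<..<sub_pt y dt M i (Suc q)} \<Longrightarrow> x \<in> cell M i \<and> x \<notin> breaks y dt M i"
proof -
  define B where "B = breaks y dt M i"
  define a where "a = real i / real M"
  define b where "b = (real i + 1) / real M"
  define L where "L = [a] @ sorted_list_of_set B @ [b]"
  have sub: "sub_pt y dt M i q = L ! q" for q
    by (simp add: sub_pt_def L_def a_def b_def B_def)
  have finB: "finite B" using fin by (simp add: B_def)
  have cell: "cell M i = {a<..<b}"
    by (simp add: cell_def a_def b_def)
  have ab: "a < b" using M by (simp add: a_def b_def divide_strict_right_mono)
  have "B \<subseteq> {a<..<b}"
    unfolding B_def cell[symmetric] by (auto simp: breaks_def)
  then have sorted: "sorted_wrt (<) L"
    using finB ab unfolding L_def by (auto simp: sorted_wrt_append)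
  have len: "length L = card B + 2"
    using finB by (simp add: L_def)
  have less: "L ! m < L ! n" if "m < n" "n \<le> Suc (card B)" for m n
    using sorted_wrt_nth_less[OF sorted that(1)] that(2) len by simp
  then have le: "L ! m \<le> L ! n" if "m \<le> n" "n \<le> Suc (card B)" for m n
    using that by (cases "m = n") (auto intro: less_imp_le)
  have L0: "L ! 0 = a" by (simp add: L_def)
  have Lb: "L ! Suc (card B) = b" using finB by (simp add: L_def nth_append)
  show "sub_pt y dt M i 0 = real i / real M"
    using L0 by (simp add: sub a_def)
  show "sub_pt y dt M i (Suc (card (breaks y dt M i))) = (real i + 1) / real M"
    using Lb by (simp add: sub b_def B_def)
  show "sub_pt y dt M i q < sub_pt y dt M i (Suc q)" if "q \<le> card (breaks y dt M i)"
    unfolding sub using that by (intro less) (auto simp: B_def)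
  show "x \<in> cell M i \<and> x \<notin> breaks y dt M i" if q: "q \<le> card (breaks y dt M i)"
    and x: "x \<in> {sub_pt y dt M i q<..<sub_pt y dt M i (Suc q)}"
  proof
    have q': "q \<le> card B" using q by (simp add: B_def)
    have "a \<le> L ! q" "L ! Suc q \<le> b"
      using le[of 0 q] le[of "Suc q" "Suc (card B)"] q' by (simp_all add: L0 Lb)
    then show "x \<in> cell M i"
      using x by (simp add: cell sub)
    show "x \<notin> breaks y dt M i"
    proof
      assume "x \<in> breaks y dt M i"
      then have "x \<in> set L" using finB by (simp add: L_def B_def)
      then obtain m where m: "m < length L" "L ! m = x" by (auto simp: in_set_conv_nth)
      have "L ! q < L ! m" "L ! m < L ! Suc q" using x m by (auto simp: sub)
      moreover have "L ! m \<le> L ! q \<or> L ! Suc q \<le> L ! m"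
        using le[of m q] le[of "Suc q" m] m(1) q' len by linarith
      ultimately show False by linarith
    qed
  qed
qed

text \<open>A point at relative position \<theta> in an interval of length \<open>h\<close> is moved
  to distance \<open>A\<close> from the left end of an interval of length \<open>h'\<close>.
  Numerator and denominator of A / h' are each distorted by a factor of at most \<open>E\<close>, so
  the ratio of the two positions is at most \<open>E\<^sup>2\<close> in either direction. As both
  positions are at most 1, this bounds their difference.\<close>

lemma relative_position_perturbation:
  fixes A E h h' \<theta> :: real
  assumes "0 < h'" "0 \<le> \<theta>" "\<theta> \<le> 1" "1 \<le> E" "0 \<le> A" "A \<le> h'"
    and "A \<le> E * (h * \<theta>)" "h * \<theta> \<le> E * A" "h' \<le> E * h" "h \<le> E * h'"
  shows "\<bar>A / h' - \<theta>\<bar> \<le> E\<^sup>2 - 1"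
proof -
  have E2: "0 \<le> E\<^sup>2 - 1" using assms(4) by (simp add: one_le_power)
  have "A \<le> E * (E * h' * \<theta>)"
    using assms by (meson mult_left_mono mult_right_mono order_trans zero_le_one)
  also have "\<dots> = \<theta> * h' + (E\<^sup>2 - 1) * (\<theta> * h')"
    by (simp add: power2_eq_square algebra_simps)
  also have "(E\<^sup>2 - 1) * (\<theta> * h') \<le> (E\<^sup>2 - 1) * h'"
    using E2 assms by (intro mult_left_mono) auto
  finally have "A \<le> (\<theta> + (E\<^sup>2 - 1)) * h'"
    by (simp add: algebra_simps)
  then have 1: "A / h' \<le> \<theta> + (E\<^sup>2 - 1)"
    using assms(1) by (simp add: divide_le_eq)
  have "h' * \<theta> \<le> E * h * \<theta>"
    using assms by (intro mult_right_mono) auto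
  also have "\<dots> = E * (h * \<theta>)" by simp
  also have "\<dots> \<le> E * (E * A)"
    using assms by (intro mult_left_mono) auto
  also have "\<dots> = A + (E\<^sup>2 - 1) * A"
    by (simp add: power2_eq_square algebra_simps)
  also have "(E\<^sup>2 - 1) * A \<le> (E\<^sup>2 - 1) * h'"
    using E2 assms by (intro mult_left_mono) auto
  finally have "(\<theta> - (E\<^sup>2 - 1)) * h' \<le> A"
    by (simp add: algebra_simps)
  then have 2: "\<theta> - (E\<^sup>2 - 1) \<le> A / h'"
    using assms(1) by (simp add: le_divide_eq)
  show ?thesis using 1 2 by (simp add: abs_le_iff)
qed

section \<open>Well-posedness of the scheme and estimates for the quadrature form\<close>

locale transport_scheme = lipschitz_flow b y K + gauss_rule k \<xi> w
  for b :: "real \<Rightarrow> real" and y :: "real \<Rightarrow> real \<Rightarrow> real" and K :: real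
    and k :: nat and \<xi> w :: "nat \<Rightarrow> real" +
  fixes M :: nat and dt :: real
  assumes M_pos: "0 < M" and dt_nonneg: "0 \<le> dt"
begin

abbreviation \<Phi> :: "real \<Rightarrow> real" where
  "\<Phi> x \<equiv> y x (- dt)"

abbreviation pts :: "nat \<Rightarrow> nat \<Rightarrow> real" where
  "pts i q \<equiv> sub_pt y dt M i q"

abbreviation nbreaks :: "nat \<Rightarrow> nat" where
  "nbreaks i \<equiv> card (breaks y dt M i)"

text \<open>The inverse flow recovers a breakpoint from the mesh node it meets, and that node lies
  in the bounded image of the cell, which contains finitely many.\<close>

lemma finite_breaks: "finite (breaks y dt M i)"
proof -
  define lo where "lo = \<lfloor>\<Phi> (real i / real M) * real M\<rfloor>"
  define hi where "hi = \<lceil>\<Phi> ((real i + 1) / real M) * real M\<rceil>"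
  have "breaks y dt M i \<subseteq> (\<lambda>j. y (real_of_int j / real M) dt) ` {lo..hi}"
  proof
    fix x assume "x \<in> breaks y dt M i"
    then obtain j :: int where x: "x \<in> cell M i" and j: "\<Phi> x = real_of_int j / real M"
      by (auto simp: breaks_def)
    have "\<Phi> (real i / real M) \<le> \<Phi> x" "\<Phi> x \<le> \<Phi> ((real i + 1) / real M)"
      using x by (auto simp: cell_def intro!: flow_le)
    then have "\<Phi> (real i / real M) * real M \<le> real_of_int j" "real_of_int j \<le> \<Phi> ((real i + 1) / real M) * real M"
      using M_pos by (simp_all add: j field_simps)
    then have "j \<in> {lo..hi}"
      unfolding lo_def hi_def by (simp add: floor_le_iff le_ceiling_iff)
    moreover have "x = y (real_of_int j / real M) dt"
      using flow_inverse(2)[of x dt] by (simp add: j)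
    ultimately show "x \<in> (\<lambda>j. y (real_of_int j / real M) dt) ` {lo..hi}" by blast
  qed
  then show ?thesis by (rule finite_subset) simp
qed

lemmas pts_0 = sub_pt_0[OF M_pos finite_breaks]
  and pts_last = sub_pt_last[OF M_pos finite_breaks]
  and pts_less = sub_pt_less[OF M_pos finite_breaks]
  and pts_between = sub_pt_between[OF M_pos finite_breaks]

lemma node_in_cell:
  assumes "q \<le> nbreaks i" "\<alpha> \<le> k"
  shows "gauss_node \<xi> (pts i q) (pts i (Suc q)) \<alpha> \<in> cell M i"
  using pts_between[OF assms(1) gauss_node_in[OF assms(2) pts_less[OF assms(1)]]] by simp

lemma innerG_eq: "innerG k \<xi> w y dt M f g =
  (\<Sum>i<M. \<Sum>q<Suc (nbreaks i). \<Sum>\<alpha>\<le>k. w \<alpha> / 2 * (pts i (Suc q) - pts i q) *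
     f (gauss_node \<xi> (pts i q) (pts i (Suc q)) \<alpha>) * g (gauss_node \<xi> (pts i q) (pts i (Suc q)) \<alpha>))"
  by (simp add: innerG_def quad_weight_def quad_node_def gauss_node_def lessThan_Suc_atMost)

text \<open>The right-hand side of the scheme samples the test function only at quadrature nodes,
  all of them inside cells. The representation result for such functionals therefore gives the
  existence and uniqueness by which the description in \<open>Tscheme\<close> denotes.\<close>

lemma Tscheme_spec:
  shows Tscheme_in_V: "Tscheme k \<xi> w y dt M u \<in> V k M"
    and L2inner_Tscheme: "\<phi> \<in> V k M \<Longrightarrow>
      L2inner (Tscheme k \<xi> w y dt M u) \<phi> = innerG k \<xi> w y dt M (\<lambda>x. u (\<Phi> x)) \<phi>"
proof -
  let ?node = "\<lambda>i (q, \<alpha>). gauss_node \<xi> (pts i q) (pts i (Suc q)) \<alpha>"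
  let ?c = "\<lambda>i (q, \<alpha>). w \<alpha> / 2 * (pts i (Suc q) - pts i q) * u (\<Phi> (?node i (q, \<alpha>)))"
  have "\<exists>!v. v \<in> V k M \<and> (\<forall>j :: int. v (real_of_int j / real M) = 0) \<and>
      (\<forall>\<phi>\<in>V k M. L2inner v \<phi> =
        (\<Sum>i<M. \<Sum>j\<in>{..<Suc (nbreaks i)} \<times> {..k}. ?c i j * \<phi> (?node i j)))"
    by (rule V_riesz[OF M_pos]) (auto simp: node_in_cell)
  moreover have "(\<Sum>i<M. \<Sum>j\<in>{..<Suc (nbreaks i)} \<times> {..k}. ?c i j * \<phi> (?node i j)) =
      innerG k \<xi> w y dt M (\<lambda>x. u (\<Phi> x)) \<phi>" for \<phi>
    unfolding innerG_eq by (simp add: sum.cartesian_product case_prod_unfold)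
  ultimately have "\<exists>!v. v \<in> V k M \<and> (\<forall>j :: int. v (real_of_int j / real M) = 0) \<and>
      (\<forall>\<phi>\<in>V k M. L2inner v \<phi> = innerG k \<xi> w y dt M (\<lambda>x. u (\<Phi> x)) \<phi>)"
    by simp
  from theI'[OF this] show "Tscheme k \<xi> w y dt M u \<in> V k M"
    "\<phi> \<in> V k M \<Longrightarrow>
      L2inner (Tscheme k \<xi> w y dt M u) \<phi> = innerG k \<xi> w y dt M (\<lambda>x. u (\<Phi> x)) \<phi>"
    unfolding Tscheme_def by auto
qed

text \<open>The monotone map \<open>\<Psi>\<close> allows one summation to serve both for the
  subdivided mesh itself and for its image under the flow.\<close>

lemma has_integral_cells:
  fixes f :: "real \<Rightarrow> real" and \<Psi> :: "real \<Rightarrow> real"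
  assumes \<Psi>: "mono \<Psi>"
    and I: "\<And>i q. i < M \<Longrightarrow> q \<le> nbreaks i \<Longrightarrow> (f has_integral I i q) {\<Psi> (pts i q)..\<Psi> (pts i (Suc q))}"
  shows "(f has_integral (\<Sum>i<M. \<Sum>q<Suc (nbreaks i). I i q)) {\<Psi> 0..\<Psi> 1}"
proof -
  have "(f has_integral (\<Sum>i<M. \<Sum>q<Suc (nbreaks i). I i q))
      {\<Psi> (real 0 / real M)..\<Psi> (real M / real M)} \<and> \<Psi> (real 0 / real M) \<le> \<Psi> (real M / real M)"
  proof (rule has_integral_telescope[where c = "\<lambda>i. \<Psi> (real i / real M)"])
    fix i assume i: "i < M"
    show "\<Psi> (real i / real M) \<le> \<Psi> (real (Suc i) / real M)"
      by (intro monoD[OF \<Psi>] divide_right_mono) auto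
    have "(f has_integral (\<Sum>q<Suc (nbreaks i). I i q)) {\<Psi> (pts i 0)..\<Psi> (pts i (Suc (nbreaks i)))} \<and>
        \<Psi> (pts i 0) \<le> \<Psi> (pts i (Suc (nbreaks i)))"
    proof (rule has_integral_telescope[where c = "\<lambda>q. \<Psi> (pts i q)"])
      fix q assume "q < Suc (nbreaks i)"
      then have q: "q \<le> nbreaks i" by simp
      show "\<Psi> (pts i q) \<le> \<Psi> (pts i (Suc q))"
        using pts_less[OF q] by (intro monoD[OF \<Psi>]) simp
      show "(f has_integral I i q) {\<Psi> (pts i q)..\<Psi> (pts i (Suc q))}"
        by (rule I[OF i q])
    qed
    then show "(f has_integral (\<Sum>q<Suc (nbreaks i). I i q)) {\<Psi> (real i / real M)..\<Psi> (real (Suc i) / real M)}"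
      unfolding pts_0 pts_last by (simp add: add.commute)
  qed
  then show ?thesis using M_pos by simp
qed

text \<open>A polynomial on a cell is a polynomial on every piece of it, so subdividing at the
  breakpoints preserves exactness.\<close>

lemma innerG_V:
  assumes f: "f \<in> V k M" and g: "g \<in> V k M"
  shows "innerG k \<xi> w y dt M f g = L2inner f g"
proof -
  have "((\<lambda>x. f x * g x) has_integral innerG k \<xi> w y dt M f g) {0..1}"
    unfolding innerG_eq
  proof (rule has_integral_cells[where \<Psi> = "\<lambda>x. x"])
    fix i q assume i: "i < M" and q: "q \<le> nbreaks i"
    obtain p where p: "degree p \<le> k" "\<And>x. x \<in> cell M i \<Longrightarrow> f x = poly p x"
      using V_cell_poly[OF f i] by blast
    obtain r where r: "degree r \<le> k" "\<And>x. x \<in> cell M i \<Longrightarrow> g x = poly r x"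
      using V_cell_poly[OF g i] by blast
    show "((\<lambda>x. f x * g x) has_integral (\<Sum>\<alpha>\<le>k. w \<alpha> / 2 * (pts i (Suc q) - pts i q) *
        f (gauss_node \<xi> (pts i q) (pts i (Suc q)) \<alpha>) * g (gauss_node \<xi> (pts i q) (pts i (Suc q)) \<alpha>)))
        {pts i q..pts i (Suc q)}"
      using pts_between[OF q] p r by (intro gauss_has_integral[OF pts_less[OF q]]) auto
  qed (simp add: mono_def)
  then show ?thesis
    using f g by (intro L2inner_eq[symmetric]) (auto dest: V_L2per)
qed

text \<open>This is the purpose of the breakpoints. A mesh node strictly inside the image of a
  subinterval would flow back to a breakpoint strictly inside the subinterval, so the image fits
  into a single mesh interval.\<close>

lemma transported_poly:
  assumes u: "u \<in> V k M" and q: "q \<le> nbreaks i"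
  obtains p where "degree p \<le> k" "\<And>z. z \<in> {\<Phi> (pts i q)<..<\<Phi> (pts i (Suc q))} \<Longrightarrow> u z = poly p z"
proof -
  define a' where "a' = \<Phi> (pts i q)"
  define b' where "b' = \<Phi> (pts i (Suc q))"
  have no_node: "\<not> (a' < real_of_int j / real M \<and> real_of_int j / real M < b')" for j
  proof
    assume j: "a' < real_of_int j / real M \<and> real_of_int j / real M < b'"
    define x where "x = y (real_of_int j / real M) dt"
    have x: "\<Phi> x = real_of_int j / real M" by (simp add: x_def flow_inverse)
    have "pts i q < x" "x < pts i (Suc q)"
      using j flow_le[of x "pts i q" "- dt"] flow_le[of "pts i (Suc q)" x "- dt"]
      by (auto simp: a'_def b'_def x not_le[symmetric])
    then have "x \<in> cell M i \<and> x \<notin> breaks y dt M i"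
      by (intro pts_between[OF q]) simp
    then show False using x by (auto simp: breaks_def)
  qed
  \<comment> \<open>The mesh node with index \<open>j\<close> is the last one not to the right of
    \<open>a'\<close>. The next node lies to the right of \<open>a'\<close>, so by
    \<open>no_node\<close> it is not before \<open>b'\<close>.\<close>
  define j where "j = \<lfloor>a' * real M\<rfloor>"
  have "real_of_int j \<le> a' * real M" "a' * real M < real_of_int j + 1"
    unfolding j_def by linarith+
  then have j: "real_of_int j / real M \<le> a'" "a' < real_of_int (j + 1) / real M"
    using M_pos by (simp_all add: field_simps)
  have "b' \<le> real_of_int (j + 1) / real M"
    using no_node[of "j + 1"] j by linarith
  moreover obtain p where "degree p \<le> k"
    "\<And>x. x \<in> {real_of_int j / real M<..<(real_of_int j + 1) / real M} \<Longrightarrow> u x = poly p x"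
    using V_translated_cell_poly[OF u M_pos] by blast
  ultimately show thesis
    using j by (intro that[of p]) (auto simp: a'_def b'_def)
qed

text \<open>With E = exp (K dt), replacing the length of a subinterval by that of its image costs a
  factor \<open>E\<close>, and replacing the transported nodes by the Gauss nodes of the image costs
  1 + 2 n (E^2 - 1), which is at most E^(4 n). The product is the exponential in the claim. The
  exact Gauss sums over the images add up to the squared norm of \<open>u\<close> over one
  period.\<close>

lemma innerG_transported_le:
  fixes n :: nat
  assumes u: "u \<in> V k M"
    and pert: "\<And>p z \<delta>. degree p \<le> k \<Longrightarrow>
      (\<And>\<alpha>. \<alpha> \<le> k \<Longrightarrow> \<bar>z \<alpha>\<bar> \<le> 1 \<and> \<bar>z \<alpha> - \<xi> \<alpha>\<bar> \<le> \<delta>) \<Longrightarrow>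
      (\<Sum>\<alpha>\<le>k. w \<alpha> * (poly p (z \<alpha>))\<^sup>2) \<le> (1 + real n * \<delta>) * (\<Sum>\<alpha>\<le>k. w \<alpha> * (poly p (\<xi> \<alpha>))\<^sup>2)"
  shows "innerG k \<xi> w y dt M (\<lambda>x. u (\<Phi> x)) (\<lambda>x. u (\<Phi> x)) \<le> exp ((1 + 4 * real n) * K * dt) * (L2norm u)\<^sup>2"
proof -
  define E where "E = exp (K * dt)"
  define F where "F = exp ((1 + 4 * real n) * K * dt)"
  have E1: "1 \<le> E" using K_nonneg dt_nonneg by (simp add: E_def)
  define I where "I = (\<lambda>i q. \<Sum>\<alpha>\<le>k. w \<alpha> / 2 * (\<Phi> (pts i (Suc q)) - \<Phi> (pts i q)) *
    u (gauss_node \<xi> (\<Phi> (pts i q)) (\<Phi> (pts i (Suc q))) \<alpha>) * u (gauss_node \<xi> (\<Phi> (pts i q)) (\<Phi> (pts i (Suc q))) \<alpha>))"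
  have "((\<lambda>x. u x * u x) has_integral (\<Sum>i<M. \<Sum>q<Suc (nbreaks i). I i q)) {\<Phi> 0..\<Phi> 1}"
  proof (rule has_integral_cells)
    show "mono \<Phi>" by (simp add: mono_def flow_le)
    fix i q assume i: "i < M" and q: "q \<le> nbreaks i"
    obtain p where p: "degree p \<le> k" "\<And>z. z \<in> {\<Phi> (pts i q)<..<\<Phi> (pts i (Suc q))} \<Longrightarrow> u z = poly p z"
      using transported_poly[OF u q] by blast
    show "((\<lambda>x. u x * u x) has_integral I i q) {\<Phi> (pts i q)..\<Phi> (pts i (Suc q))}"
      unfolding I_def by (rule gauss_has_integral[OF flow_less[OF pts_less[OF q]] p p])
  qed
  moreover have "\<Phi> 1 = \<Phi> 0 + 1" using flow_plus_1[of 0] by simp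
  ultimately have I_le: "(\<Sum>i<M. \<Sum>q<Suc (nbreaks i). I i q) \<le> (L2norm u)\<^sup>2"
    using has_integral_period_le[OF V_L2per[OF u]] by simp
  have cell_le: "(\<Sum>\<alpha>\<le>k. w \<alpha> / 2 * (pts i (Suc q) - pts i q) *
      u (\<Phi> (gauss_node \<xi> (pts i q) (pts i (Suc q)) \<alpha>)) * u (\<Phi> (gauss_node \<xi> (pts i q) (pts i (Suc q)) \<alpha>)))
      \<le> F * I i q" if q: "q \<le> nbreaks i" for i q
  proof -
    obtain p where p: "degree p \<le> k" "\<And>z. z \<in> {\<Phi> (pts i q)<..<\<Phi> (pts i (Suc q))} \<Longrightarrow> u z = poly p z"
      using transported_poly[OF u q] by blast
    define a where "a = pts i q"
    define c where "c = pts i (Suc q)"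
    define h where "h = c - a"
    define h' where "h' = \<Phi> c - \<Phi> a"
    have ac: "a < c" using pts_less[OF q] by (simp add: a_def c_def)
    have h: "0 < h" "0 < h'" using ac flow_less[OF ac, of "- dt"] by (simp_all add: h_def h'_def)
    have incr: "\<Phi> x' - \<Phi> x \<le> E * (x' - x)" "x' - x \<le> E * (\<Phi> x' - \<Phi> x)" if "x \<le> x'" for x x'
      using flow_increment[OF that, of "- dt"] dt_nonneg by (simp_all add: E_def)
    have hh': "h' \<le> E * h" "h \<le> E * h'"
      using incr[of a c] ac by (simp_all add: h_def h'_def)
    define x where "x = (\<lambda>\<alpha>. gauss_node \<xi> a c \<alpha>)"
    \<comment> \<open>Position of the transported node within the image interval, rescaled to
      [-1, 1]. The polynomial \<open>r\<close> below is \<open>u\<close> in this reference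
      coordinate.\<close>
    define z where "z = (\<lambda>\<alpha>. 2 * ((\<Phi> (x \<alpha>) - \<Phi> a) / h') - 1)"
    define r where "r = pcompose p [: (\<Phi> a + \<Phi> c) / 2, h' / 2 :]"
    have r_deg: "degree r \<le> k"
      unfolding r_def degree_pcompose using p(1) by (auto intro: order_trans[of _ "degree p"])
    have u_z: "u (\<Phi> (x \<alpha>)) = poly r (z \<alpha>)" if \<alpha>: "\<alpha> \<le> k" for \<alpha>
    proof -
      have "x \<alpha> \<in> {a<..<c}" unfolding x_def by (rule gauss_node_in[OF \<alpha> ac])
      then have "\<Phi> (x \<alpha>) \<in> {\<Phi> a<..<\<Phi> c}" by (simp add: flow_less)
      then have "u (\<Phi> (x \<alpha>)) = poly p (\<Phi> (x \<alpha>))" using p(2) by (simp add: a_def c_def)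
      moreover have "(\<Phi> a + \<Phi> c) / 2 + z \<alpha> * (h' / 2) = \<Phi> (x \<alpha>)"
      proof -
        have "z \<alpha> * (h' / 2) = (\<Phi> (x \<alpha>) - \<Phi> a) - h' / 2"
        proof -
          have "(2 * (s / h') - 1) * (h' / 2) = s - h' / 2" for s
            using h(2) by (simp add: left_diff_distrib)
          then show ?thesis unfolding z_def .
        qed
        then show ?thesis by (simp add: h'_def field_simps)
      qed
      ultimately show ?thesis by (simp add: r_def poly_pcompose)
    qed
    have u_\<xi>: "u (gauss_node \<xi> (\<Phi> a) (\<Phi> c) \<alpha>) = poly r (\<xi> \<alpha>)" if \<alpha>: "\<alpha> \<le> k" for \<alpha>
    proof -
      have "gauss_node \<xi> (\<Phi> a) (\<Phi> c) \<alpha> \<in> {\<Phi> a<..<\<Phi> c}"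
        by (rule gauss_node_in[OF \<alpha> flow_less[OF ac]])
      then have "u (gauss_node \<xi> (\<Phi> a) (\<Phi> c) \<alpha>) = poly p (gauss_node \<xi> (\<Phi> a) (\<Phi> c) \<alpha>)"
        using p(2) by (simp add: a_def c_def)
      then show ?thesis by (simp add: r_def poly_pcompose gauss_node_def h'_def)
    qed
    \<comment> \<open>The factor 2 arises because relative positions refer to [0, 1], whereas the
      reference interval [-1, 1] has length 2.\<close>
    have z_pert: "\<bar>z \<alpha>\<bar> \<le> 1 \<and> \<bar>z \<alpha> - \<xi> \<alpha>\<bar> \<le> 2 * (E\<^sup>2 - 1)" if \<alpha>: "\<alpha> \<le> k" for \<alpha>
    proof -
      define \<theta> where "\<theta> = (1 + \<xi> \<alpha>) / 2"
      define A where "A = \<Phi> (x \<alpha>) - \<Phi> a"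
      have x: "a < x \<alpha>" "x \<alpha> < c"
        using gauss_node_in[OF \<alpha> ac] by (auto simp: x_def)
      have xh: "x \<alpha> - a = h * \<theta>"
        by (simp add: x_def gauss_node_def h_def \<theta>_def field_simps)
      have A: "0 \<le> A" "A \<le> h'"
        using flow_less[OF x(1), of "- dt"] flow_less[OF x(2), of "- dt"] by (simp_all add: A_def h'_def)
      have "\<bar>A / h' - \<theta>\<bar> \<le> E\<^sup>2 - 1"
      proof (rule relative_position_perturbation[of _ _ _ _ h])
        show "A \<le> E * (h * \<theta>)" "h * \<theta> \<le> E * A"
          using incr[of a "x \<alpha>"] x by (simp_all add: A_def xh)
        show "0 \<le> \<theta>" "\<theta> \<le> 1"
          using node_bounds[OF \<alpha>] by (simp_all add: \<theta>_def)
      qed (use h hh' A E1 in auto)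
      moreover have "2 * \<theta> = 1 + \<xi> \<alpha>"
        by (simp add: \<theta>_def)
      then have "z \<alpha> - \<xi> \<alpha> = 2 * (A / h' - \<theta>)"
        by (simp add: z_def A_def right_diff_distrib)
      ultimately have "\<bar>z \<alpha> - \<xi> \<alpha>\<bar> \<le> 2 * (E\<^sup>2 - 1)"
        by (simp add: abs_mult)
      moreover have "0 \<le> A / h'" "A / h' \<le> 1"
        using A h by (simp_all add: divide_le_eq)
      then have "\<bar>z \<alpha>\<bar> \<le> 1"
      proof -
        have "z \<alpha> = 2 * (A / h') - 1" by (simp only: z_def A_def)
        with \<open>0 \<le> A / h'\<close> \<open>A / h' \<le> 1\<close> show ?thesis by linarith
      qed
      ultimately show ?thesis by simp
    qed
    define S where "S = (\<Sum>\<alpha>\<le>k. w \<alpha> * (poly r (\<xi> \<alpha>))\<^sup>2)"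
    have S0: "0 \<le> S"
      unfolding S_def using weight_pos by (auto intro!: sum_nonneg simp: less_imp_le)
    \<comment> \<open>Bernoulli's inequality turns the additive loss into a power of
      \<open>E\<close>, so that the total loss is a pure exponential in \<open>dt\<close> without
      any smallness condition on \<open>dt\<close>.\<close>
    have "1 + real n * (2 * (E\<^sup>2 - 1)) = 1 + real (2 * n) * (E\<^sup>2 - 1)"
      by simp
    also have "\<dots> \<le> (1 + (E\<^sup>2 - 1)) ^ (2 * n)"
      by (intro Bernoulli_inequality) simp
    finally have bern: "1 + real n * (2 * (E\<^sup>2 - 1)) \<le> (E\<^sup>2) ^ (2 * n)"
      by simp
    have EF: "E * (E\<^sup>2) ^ (2 * n) = F"
    proof -
      have "E * (E\<^sup>2) ^ (2 * n) = E ^ (1 + 4 * n)"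
        by (simp add: power_mult[symmetric])
      also have "\<dots> = exp (real (1 + 4 * n) * (K * dt))"
        unfolding E_def by (rule exp_of_nat_mult[symmetric])
      finally show ?thesis by (simp add: F_def mult.assoc)
    qed
    have "(\<Sum>\<alpha>\<le>k. w \<alpha> / 2 * h * u (\<Phi> (x \<alpha>)) * u (\<Phi> (x \<alpha>))) = h / 2 * (\<Sum>\<alpha>\<le>k. w \<alpha> * (poly r (z \<alpha>))\<^sup>2)"
      unfolding sum_distrib_left by (intro sum.cong) (simp_all add: u_z power2_eq_square)
    also have "\<dots> \<le> h / 2 * ((E\<^sup>2) ^ (2 * n) * S)"
    proof (rule mult_left_mono)
      have "(\<Sum>\<alpha>\<le>k. w \<alpha> * (poly r (z \<alpha>))\<^sup>2) \<le> (1 + real n * (2 * (E\<^sup>2 - 1))) * S"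
        unfolding S_def by (rule pert[OF r_deg z_pert])
      also have "\<dots> \<le> (E\<^sup>2) ^ (2 * n) * S"
        using bern S0 by (rule mult_right_mono)
      finally show "(\<Sum>\<alpha>\<le>k. w \<alpha> * (poly r (z \<alpha>))\<^sup>2) \<le> (E\<^sup>2) ^ (2 * n) * S" .
    qed (use h in simp)
    also have "\<dots> \<le> E * h' / 2 * ((E\<^sup>2) ^ (2 * n) * S)"
      using hh' S0 by (intro mult_right_mono) auto
    also have "\<dots> = F * (h' / 2 * S)"
      by (simp add: EF[symmetric])
    also have "h' / 2 * S = (\<Sum>\<alpha>\<le>k. w \<alpha> / 2 * h' *
        u (gauss_node \<xi> (\<Phi> a) (\<Phi> c) \<alpha>) * u (gauss_node \<xi> (\<Phi> a) (\<Phi> c) \<alpha>))"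
      unfolding S_def sum_distrib_left by (intro sum.cong) (simp_all add: u_\<xi> power2_eq_square)
    also have "\<dots> = I i q"
      by (simp add: I_def h'_def a_def c_def)
    finally show ?thesis
      by (simp add: h_def a_def c_def x_def)
  qed
  have "innerG k \<xi> w y dt M (\<lambda>x. u (\<Phi> x)) (\<lambda>x. u (\<Phi> x)) \<le> (\<Sum>i<M. \<Sum>q<Suc (nbreaks i). F * I i q)"
    unfolding innerG_eq by (intro sum_mono cell_le) auto
  also have "\<dots> = F * (\<Sum>i<M. \<Sum>q<Suc (nbreaks i). I i q)"
    by (simp only: sum_distrib_left)
  also have "\<dots> \<le> F * (L2norm u)\<^sup>2"
    using I_le by (intro mult_left_mono) (simp_all add: F_def)
  finally show ?thesis by (simp add: F_def)
qed

lemma Tscheme_stable: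
  fixes n :: nat
  assumes u: "u \<in> V k M"
    and pert: "\<And>p z \<delta>. degree p \<le> k \<Longrightarrow>
      (\<And>\<alpha>. \<alpha> \<le> k \<Longrightarrow> \<bar>z \<alpha>\<bar> \<le> 1 \<and> \<bar>z \<alpha> - \<xi> \<alpha>\<bar> \<le> \<delta>) \<Longrightarrow>
      (\<Sum>\<alpha>\<le>k. w \<alpha> * (poly p (z \<alpha>))\<^sup>2) \<le> (1 + real n * \<delta>) * (\<Sum>\<alpha>\<le>k. w \<alpha> * (poly p (\<xi> \<alpha>))\<^sup>2)"
  shows "L2norm (Tscheme k \<xi> w y dt M u) \<le> exp ((1 + 4 * real n) * K / 2 * dt) * L2norm u"
proof -
  define v where "v = Tscheme k \<xi> w y dt M u"
  define f where "f = (\<lambda>x. u (\<Phi> x))"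
  have v: "v \<in> V k M" unfolding v_def by (rule Tscheme_in_V)
  have "(L2norm v)\<^sup>2 = innerG k \<xi> w y dt M f v"
    unfolding L2norm_power2 using L2inner_Tscheme[OF v] by (simp add: v_def f_def)
  also have "\<dots> \<le> (innerG k \<xi> w y dt M f f + innerG k \<xi> w y dt M v v) / 2"
    unfolding innerG_eq add_divide_distrib sum_divide_distrib sum.distrib[symmetric]
  proof (intro sum_mono)
    fix i q \<alpha> assume "q \<in> {..<Suc (nbreaks i)}" "\<alpha> \<in> {..k}"
    then have W: "0 \<le> w \<alpha> / 2 * (pts i (Suc q) - pts i q)"
      using pts_less[of q i] weight_pos[of \<alpha>] by simp
    have "s * t \<le> (s * s + t * t) / 2" for s t :: real
      using sum_squares_bound[of s t] by (simp add: power2_eq_square)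
    from mult_left_mono[OF this W]
    show "w \<alpha> / 2 * (pts i (Suc q) - pts i q) * f (gauss_node \<xi> (pts i q) (pts i (Suc q)) \<alpha>) *
        v (gauss_node \<xi> (pts i q) (pts i (Suc q)) \<alpha>)
      \<le> w \<alpha> / 2 * (pts i (Suc q) - pts i q) * f (gauss_node \<xi> (pts i q) (pts i (Suc q)) \<alpha>) *
        f (gauss_node \<xi> (pts i q) (pts i (Suc q)) \<alpha>) / 2 +
        w \<alpha> / 2 * (pts i (Suc q) - pts i q) * v (gauss_node \<xi> (pts i q) (pts i (Suc q)) \<alpha>) *
        v (gauss_node \<xi> (pts i q) (pts i (Suc q)) \<alpha>) / 2"
      by (simp only: mult.assoc distrib_left add_divide_distrib times_divide_eq_right)
  qed
  also have "innerG k \<xi> w y dt M v v = (L2norm v)\<^sup>2"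
    using innerG_V[OF v v] by (simp add: L2norm_power2)
  \<comment> \<open>Half of the squared norm of \<open>v\<close> stood on the right and has been
    absorbed into the left, so the factor 1/2 disappears from both sides.\<close>
  finally have "(L2norm v)\<^sup>2 \<le> innerG k \<xi> w y dt M f f"
    by simp
  also have "\<dots> \<le> exp ((1 + 4 * real n) * K * dt) * (L2norm u)\<^sup>2"
    unfolding f_def by (rule innerG_transported_le[OF u pert])
  also have "\<dots> = (exp ((1 + 4 * real n) * K / 2 * dt) * L2norm u)\<^sup>2"
    by (simp add: power_mult_distrib exp_double[symmetric])
  finally show ?thesis
    unfolding v_def by (rule power2_le_imp_le) (simp add: L2norm_nonneg)
qed

end

theorem proposition2p2:
  fixes k :: nat and b :: "real \<Rightarrow> real" and y :: "real \<Rightarrow> real \<Rightarrow> real"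
    and \<xi> w :: "nat \<Rightarrow> real" and T :: real
  assumes T_pos: "0 < T"
    and lipschitz: "\<exists>K. K-lipschitz_on UNIV b"
    and periodic: "periodic_fun_simple' b"
    and char: "characteristics b y"
    and gauss: "gauss_legendre k \<xi> w"
  shows
    "(\<forall>u\<in>L2per. \<forall>t. (\<lambda>x. u (y x (- t))) \<in> L2per \<and>
        L2norm (\<lambda>x. u (y x (- t))) \<le> exp (1 / 2 * Linf_deriv b * \<bar>t\<bar>) * L2norm u) \<and>
     (class_C (2 * k + 2) b \<longrightarrow>
        (\<exists>C1\<ge>0. \<forall>N\<ge>1. \<forall>M\<ge>1. let dt = T / real N in
           (\<forall>u\<in>V k M. L2norm (Tscheme k \<xi> w y dt M u) \<le> exp (C1 * dt) * L2norm u) \<and>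
           (\<forall>U :: nat \<Rightarrow> real \<Rightarrow> real.
              U 0 \<in> V k M \<and> (\<forall>n. U (Suc n) = Tscheme k \<xi> w y dt M (U n)) \<longrightarrow>
              (\<forall>n. L2norm (U n) \<le> exp (C1 * (real n * dt)) * L2norm (U 0)))))"
proof (intro conjI ballI allI impI)
  obtain K where K: "K-lipschitz_on UNIV b"
    using lipschitz by blast
  interpret sharp: lipschitz_flow b y "Linf_deriv b"
    by (intro lipschitz_flow.intro lipschitz_Linf_deriv[OF K periodic] periodic char)
  show "(\<lambda>x. u (y x (- t))) \<in> L2per" if "u \<in> L2per" for u t
    by (rule sharp.flow_L2per(1)[OF that])
  show "L2norm (\<lambda>x. u (y x (- t))) \<le> exp (1 / 2 * Linf_deriv b * \<bar>t\<bar>) * L2norm u"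
    if "u \<in> L2per" for u t
    by (rule sharp.flow_L2per(2)[OF that])
  interpret gauss_rule k \<xi> w
    by unfold_locales (rule gauss)
  obtain \<Lambda> where \<Lambda>: "0 \<le> \<Lambda>" "\<And>q z \<delta>. degree q \<le> k \<Longrightarrow>
      (\<And>\<alpha>. \<alpha> \<le> k \<Longrightarrow> \<bar>z \<alpha>\<bar> \<le> 1 \<and> \<bar>z \<alpha> - \<xi> \<alpha>\<bar> \<le> \<delta>) \<Longrightarrow>
      (\<Sum>\<alpha>\<le>k. w \<alpha> * (poly q (z \<alpha>))\<^sup>2) \<le> (1 + \<Lambda> * \<delta>) * (\<Sum>\<alpha>\<le>k. w \<alpha> * (poly q (\<xi> \<alpha>))\<^sup>2)"
    using gauss_sum_perturbation by blast
  \<comment> \<open>The perturbation constant is rounded up to an integer so that it can serve as an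
    exponent in Bernoulli's inequality.\<close>
  obtain n :: nat where n: "\<Lambda> \<le> real n"
    using real_arch_simple by blast
  have pert: "(\<Sum>\<alpha>\<le>k. w \<alpha> * (poly q (z \<alpha>))\<^sup>2) \<le> (1 + real n * \<delta>) * (\<Sum>\<alpha>\<le>k. w \<alpha> * (poly q (\<xi> \<alpha>))\<^sup>2)"
    if q: "degree q \<le> k" and z: "\<And>\<alpha>. \<alpha> \<le> k \<Longrightarrow> \<bar>z \<alpha>\<bar> \<le> 1 \<and> \<bar>z \<alpha> - \<xi> \<alpha>\<bar> \<le> \<delta>" for q z \<delta>
  proof (rule order_trans[OF \<Lambda>(2)[OF q z] mult_right_mono])
    have "0 \<le> \<delta>" using z[of 0] by linarith
    then show "1 + \<Lambda> * \<delta> \<le> 1 + real n * \<delta>"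
      using n by (simp add: mult_right_mono)
    show "0 \<le> (\<Sum>\<alpha>\<le>k. w \<alpha> * (poly q (\<xi> \<alpha>))\<^sup>2)"
      using weight_pos by (auto intro!: sum_nonneg simp: less_imp_le)
  qed
  \<comment> \<open>Only the Lipschitz constant and the quadrature rule enter, so \<open>C1\<close>
    is fixed before \<open>N\<close> and \<open>M\<close>. The division by 2 is the square root
    taken when passing from squared norms to norms.\<close>
  define C1 where "C1 = (1 + 4 * real n) * K / 2"
  have C1: "0 \<le> C1"
    using lipschitz_on_nonneg[OF K] by (simp add: C1_def)
  show "\<exists>C1\<ge>0. \<forall>N\<ge>1. \<forall>M\<ge>1. let dt = T / real N in
      (\<forall>u\<in>V k M. L2norm (Tscheme k \<xi> w y dt M u) \<le> exp (C1 * dt) * L2norm u) \<and>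
      (\<forall>U :: nat \<Rightarrow> real \<Rightarrow> real.
        U 0 \<in> V k M \<and> (\<forall>n. U (Suc n) = Tscheme k \<xi> w y dt M (U n)) \<longrightarrow>
        (\<forall>n. L2norm (U n) \<le> exp (C1 * (real n * dt)) * L2norm (U 0)))"
    unfolding Let_def
  proof (rule exI[of _ C1], intro conjI allI impI C1 ballI)
    fix N M :: nat
    assume N: "1 \<le> N" and M: "1 \<le> M"
    define dt where "dt = T / real N"
    have "0 < M" "0 \<le> dt"
      using M T_pos by (simp_all add: dt_def)
    then have scheme: "transport_scheme b y K k \<xi> w M dt"
      by (intro transport_scheme.intro transport_scheme_axioms.intro
          lipschitz_flow.intro gauss_rule.intro K periodic char gauss)
    show step: "L2norm (Tscheme k \<xi> w y (T / real N) M u) \<le> exp (C1 * (T / real N)) * L2norm u"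
      if "u \<in> V k M" for u
      unfolding C1_def dt_def[symmetric]
      by (rule transport_scheme.Tscheme_stable[OF scheme that]) (rule pert)
    fix U :: "nat \<Rightarrow> real \<Rightarrow> real" and m :: nat
    assume U: "U 0 \<in> V k M \<and> (\<forall>n. U (Suc n) = Tscheme k \<xi> w y (T / real N) M (U n))"
    \<comment> \<open>The one-step bound holds for arguments in \<open>V k M\<close>. Every iterate
      qualifies: the initial one by assumption, the others as outputs of the scheme.\<close>
    have U_V: "U m \<in> V k M" for m
      using U transport_scheme.Tscheme_in_V[OF scheme] by (cases m) (simp_all add: dt_def)
    show "L2norm (U m) \<le> exp (C1 * (real m * (T / real N))) * L2norm (U 0)"
    proof (induction m)
      case 0
      then show ?case by simp
    next
      case (Suc m)
      have "L2norm (U (Suc m)) \<le> exp (C1 * (T / real N)) * L2norm (U m)"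
        using step[OF U_V, of m] U by simp
      also have "\<dots> \<le> exp (C1 * (T / real N)) * (exp (C1 * (real m * (T / real N))) * L2norm (U 0))"
        using Suc by (intro mult_left_mono) auto
      also have "\<dots> = exp (C1 * (T / real N) + C1 * (real m * (T / real N))) * L2norm (U 0)"
        by (simp only: exp_add mult.assoc)
      also have "C1 * (T / real N) + C1 * (real m * (T / real N)) = C1 * (real (Suc m) * (T / real N))"
        by (simp only: of_nat_Suc distrib_right distrib_left mult_1_left)
      finally show ?case .
    qed
  qed
qed

end
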